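(* Let $k$ be a field and let $H$ be a Hopf algebra over $k$ with invertible antipode $S$. For $n\ge 0$ let $\mathcal{K}^n(H)=H^{\otimes(n+1)}$, with product $\mathcal{K}^n(H)\otimes\mathcal{K}^m(H)\to\mathcal{K}^{n+m}(H)$ $$(x^0\otimes\cdots\otimes x^n)(y^0\otimes\cdots\otimes y^m)= x^0\otimes\cdots\otimes x^{n-1}\otimes x^n_{(1)}y^0S^{-1}(x^n_{(2m+1)})\otimes\cdots\otimes x^n_{(m)}y^{m-1}S^{-1}(x^n_{(m+2)})\otimes x^n_{(m+1)}y^m$$ and $d:\mathcal{K}^n(H)\to\mathcal{K}^{n+1}(H)$ $$d(h^0\otimes\cdots\otimes h^n)=-(1\otimes h^0\otimes\cdots\otimes h^n)+\sum_{j=0}^{n-1}(-1)^j\, h^0\otimes\cdots\otimes h^j_{(1)}\otimes h^j_{(2)}\otimes\cdots\otimes h^n+(-1)^n\, h^0\otimes\cdots\otimes h^{n-1}\otimes h^n_{(1)}S^{-1}(h^n_{(3)})\otimes h^n_{(2)}.$$ Then $\mathcal{K}^*(H)$ is a differential graded $k$-algebra.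
   Context: Sweedler notation $h_{(1)}\otimes\cdots\otimes h_{(r)}$ is used for iterated comultiplications. A differential graded $k$-algebra is a graded associative unital $k$-algebra with a degree $+1$ differential $d$, $d^2=0$, satisfying $d(\Psi\Phi)=d(\Psi)\Phi+(-1)^{|\Psi|}\Psi d(\Phi)$ for homogeneous $\Psi,\Phi$. *)

theory Defs
  imports
    "HOL-Library.Poly_Mapping"
    "HOL-Algebra.Module"
    "HOL-Algebra.Algebraic_Closure_Type"
begin

section \<open>Differential graded algebras\<close>

locale assoc_algebra = module R M + ring M
  for R :: "('a, 'c) ring_scheme" (structure) and M :: "('a, 'b, 'd) module_scheme" (structure) +
  assumes smult_mult_left:
      "\<lbrakk>a \<in> carrier R; x \<in> carrier M; y \<in> carrier M\<rbrakk> \<Longrightarrow>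
        (a \<odot>\<^bsub>M\<^esub> x) \<otimes>\<^bsub>M\<^esub> y = a \<odot>\<^bsub>M\<^esub> (x \<otimes>\<^bsub>M\<^esub> y)"
    and smult_mult_right:
      "\<lbrakk>a \<in> carrier R; x \<in> carrier M; y \<in> carrier M\<rbrakk> \<Longrightarrow>
        x \<otimes>\<^bsub>M\<^esub> (a \<odot>\<^bsub>M\<^esub> y) = a \<odot>\<^bsub>M\<^esub> (x \<otimes>\<^bsub>M\<^esub> y)"

text \<open>The grading is by the natural numbers and is internal: \<open>M\<close> is the direct sum of
  its submodules \<open>A n\<close>.\<close>

locale graded_algebra = assoc_algebra R M
  for R :: "('a, 'c) ring_scheme" (structure) and M :: "('a, 'b, 'd) module_scheme" (structure) +
  fixes A :: "nat \<Rightarrow> 'b set"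
  assumes degree_submodule: "submodule (A n) R M"
    and direct_sum:
      "x \<in> carrier M \<Longrightarrow>
        \<exists>!f. (\<forall>n. f n \<in> A n) \<and> finite {n. f n \<noteq> \<zero>\<^bsub>M\<^esub>} \<and>
             x = (\<Oplus>\<^bsub>M\<^esub>n\<in>{n. f n \<noteq> \<zero>\<^bsub>M\<^esub>}. f n)"
    and degree_one: "\<one>\<^bsub>M\<^esub> \<in> A 0"
    and degree_mult: "\<lbrakk>x \<in> A n; y \<in> A m\<rbrakk> \<Longrightarrow> x \<otimes>\<^bsub>M\<^esub> y \<in> A (n + m)"

locale dg_algebra = graded_algebra R M A
  for R :: "('a, 'c) ring_scheme" (structure) and M :: "('a, 'b, 'd) module_scheme" (structure)
    and A :: "nat \<Rightarrow> 'b set" +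
  fixes d :: "'b \<Rightarrow> 'b"
  assumes d_add:
      "\<lbrakk>x \<in> carrier M; y \<in> carrier M\<rbrakk> \<Longrightarrow> d (x \<oplus>\<^bsub>M\<^esub> y) = d x \<oplus>\<^bsub>M\<^esub> d y"
    and d_smult: "\<lbrakk>a \<in> carrier R; x \<in> carrier M\<rbrakk> \<Longrightarrow> d (a \<odot>\<^bsub>M\<^esub> x) = a \<odot>\<^bsub>M\<^esub> d x"
    and d_degree: "x \<in> A n \<Longrightarrow> d x \<in> A (Suc n)"
    and d_squared: "x \<in> carrier M \<Longrightarrow> d (d x) = \<zero>\<^bsub>M\<^esub>"
    and leibniz:
      "\<lbrakk>x \<in> A n; y \<in> A m\<rbrakk> \<Longrightarrow>
        d (x \<otimes>\<^bsub>M\<^esub> y) =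
          (d x \<otimes>\<^bsub>M\<^esub> y) \<oplus>\<^bsub>M\<^esub> (((\<ominus>\<^bsub>R\<^esub> \<one>\<^bsub>R\<^esub>) [^]\<^bsub>R\<^esub> n) \<odot>\<^bsub>M\<^esub> (x \<otimes>\<^bsub>M\<^esub> d y))"

section \<open>Tensor powers of a vector space\<close>

text \<open>\<open>'h list \<Rightarrow>\<^sub>0 'k\<close> is the free vector space on the words in \<open>'h\<close>. The tensor power
  \<open>H\<^sup>\<otimes>\<^sup>n\<close> is its part spanned by the words of length \<open>n\<close>, modulo the multilinearity relations.
  These relations are homogeneous in the length, so the quotient can be taken for all lengths
  at once; the result is the tensor algebra of \<open>H\<close>, and all \<open>H\<^sup>\<otimes>\<^sup>n\<close> live in one type.\<close>

definition word :: "'h list \<Rightarrow> ('h list \<Rightarrow>\<^sub>0 'k::field)" where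
  "word xs = Poly_Mapping.single xs 1"

definition wscale :: "'k::field \<Rightarrow> ('a \<Rightarrow>\<^sub>0 'k) \<Rightarrow> ('a \<Rightarrow>\<^sub>0 'k)" where
  "wscale c p = Poly_Mapping.map ((*) c) p"

lemma lookup_wscale: "Poly_Mapping.lookup (wscale c p) x = c * Poly_Mapping.lookup p x"
  by (auto simp: wscale_def Poly_Mapping.map.rep_eq when_def)

global_interpretation words: vector_space "wscale :: 'k::field \<Rightarrow> ('a \<Rightarrow>\<^sub>0 'k) \<Rightarrow> ('a \<Rightarrow>\<^sub>0 'k)"
  by unfold_locales
    (auto intro!: poly_mapping_eqI simp: lookup_wscale lookup_add algebra_simps)

definition lin_ext :: "('k \<Rightarrow> 'v \<Rightarrow> 'v) \<Rightarrow> ('a \<Rightarrow> 'v) \<Rightarrow> ('a \<Rightarrow>\<^sub>0 'k::field) \<Rightarrow> 'v::comm_monoid_add"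
  where "lin_ext s f p = (\<Sum>x\<in>Poly_Mapping.keys p. s (Poly_Mapping.lookup p x) (f x))"

locale tensor_space = vector_space scale
  for scale :: "'k::field \<Rightarrow> 'h::ab_group_add \<Rightarrow> 'h"
begin

definition tensor_relations :: "('h list \<Rightarrow>\<^sub>0 'k) set" where
  "tensor_relations = words.span
    ({word (us @ (x + y) # vs) - word (us @ x # vs) - word (us @ y # vs) | us x y vs. True} \<union>
     {word (us @ scale c x # vs) - wscale c (word (us @ x # vs)) | us c x vs. True})"

definition tensor_eq :: "(('h list \<Rightarrow>\<^sub>0 'k) \<times> ('h list \<Rightarrow>\<^sub>0 'k)) set" where
  "tensor_eq = {(p, q). p - q \<in> tensor_relations}"

definition tclass :: "('h list \<Rightarrow>\<^sub>0 'k) \<Rightarrow> ('h list \<Rightarrow>\<^sub>0 'k) set" where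
  "tclass p = tensor_eq `` {p}"

definition tensor_power :: "nat \<Rightarrow> ('h list \<Rightarrow>\<^sub>0 'k) set set" where
  "tensor_power n = words.span (word ` {xs. length xs = n}) // tensor_eq"

text \<open>In the operations on classes below, the union over all representatives is the common
  class of the values; should an operation depend on representatives, the union would fail to
  be a class.\<close>

definition tadd :: "('h list \<Rightarrow>\<^sub>0 'k) set \<Rightarrow> ('h list \<Rightarrow>\<^sub>0 'k) set \<Rightarrow> ('h list \<Rightarrow>\<^sub>0 'k) set" where
  "tadd s t = (\<Union>p\<in>s. \<Union>q\<in>t. tclass (p + q))"

definition tscale :: "'k \<Rightarrow> ('h list \<Rightarrow>\<^sub>0 'k) set \<Rightarrow> ('h list \<Rightarrow>\<^sub>0 'k) set" where
  "tscale c s = (\<Union>p\<in>s. tclass (wscale c p))"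

end

section \<open>Hopf algebras\<close>

locale comultiplication = tensor_space scale
  for scale :: "'k::field \<Rightarrow> 'h::ab_group_add \<Rightarrow> 'h" +
  fixes comult :: "'h \<Rightarrow> ('h list \<Rightarrow>\<^sub>0 'k) set"
  assumes comult_tensor: "comult h \<in> tensor_power 2"
    and comult_add: "comult (g + h) = tadd (comult g) (comult h)"
    and comult_scale: "comult (scale c h) = tscale c (comult h)"
begin

text \<open>A representative \<open>\<Sum> h\<^bsub>(1)\<^esub> \<otimes> h\<^bsub>(2)\<^esub>\<close> of \<open>comult h\<close> as a combination of words of
  length 2.\<close>

definition sweedler :: "'h \<Rightarrow> ('h list \<Rightarrow>\<^sub>0 'k)" where
  "sweedler h = (SOME p. p \<in> comult h \<and> p \<in> words.span (word ` {xs. length xs = 2}))"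

definition comult_at :: "nat \<Rightarrow> 'h list \<Rightarrow> ('h list \<Rightarrow>\<^sub>0 'k)" where
  "comult_at j xs =
    lin_ext wscale (\<lambda>z. word (take j xs @ z @ drop (Suc j) xs)) (sweedler (xs ! j))"

text \<open>\<open>comult_iter r h\<close> is \<open>h\<^bsub>(1)\<^esub> \<otimes> \<dots> \<otimes> h\<^bsub>(r+1)\<^esub>\<close>: the comultiplication is applied \<open>r\<close> times.\<close>

primrec comult_iter :: "nat \<Rightarrow> 'h \<Rightarrow> ('h list \<Rightarrow>\<^sub>0 'k)" where
  "comult_iter 0 h = word [h]"
| "comult_iter (Suc r) h = lin_ext wscale (comult_at 0) (comult_iter r h)"

end

locale coalgebra = comultiplication scale comult
  for scale :: "'k::field \<Rightarrow> 'h::ab_group_add \<Rightarrow> 'h" and comult +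
  fixes counit :: "'h \<Rightarrow> 'k"
  assumes counit_linear: "Vector_Spaces.linear scale (*) counit"
    and coassoc:
      "tclass (lin_ext wscale (comult_at 0) (sweedler h)) =
       tclass (lin_ext wscale (comult_at 1) (sweedler h))"
    and counit_left: "lin_ext scale (\<lambda>z. scale (counit (z ! 0)) (z ! 1)) (sweedler h) = h"
    and counit_right: "lin_ext scale (\<lambda>z. scale (counit (z ! 1)) (z ! 0)) (sweedler h) = h"

text \<open>The class \<open>ring_1\<close> has \<open>0 \<noteq> 1\<close>, which is no restriction: \<open>counit 1 = 1\<close> forces it.\<close>

locale bialgebra = coalgebra scale comult counit
  for scale :: "'k::field \<Rightarrow> 'h::ring_1 \<Rightarrow> 'h" and comult and counit +
  assumes scale_mult_left: "scale c x * y = scale c (x * y)"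
    and scale_mult_right: "x * scale c y = scale c (x * y)"
    and comult_one: "comult 1 = tclass (word [1, 1])"
    and comult_mult:
      "comult (g * h) =
        tclass (lin_ext wscale (\<lambda>y. lin_ext wscale (\<lambda>z. word [y ! 0 * z ! 0, y ! 1 * z ! 1])
          (sweedler h)) (sweedler g))"
    and counit_one: "counit 1 = 1"
    and counit_mult: "counit (g * h) = counit g * counit h"

locale hopf_algebra = bialgebra scale comult counit
  for scale :: "'k::field \<Rightarrow> 'h::ring_1 \<Rightarrow> 'h" and comult and counit +
  fixes antipode :: "'h \<Rightarrow> 'h"
  assumes antipode_linear: "Vector_Spaces.linear scale scale antipode"
    and antipode_left:
      "lin_ext scale (\<lambda>z. antipode (z ! 0) * z ! 1) (sweedler h) = scale (counit h) 1"
    and antipode_right: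
      "lin_ext scale (\<lambda>z. z ! 0 * antipode (z ! 1)) (sweedler h) = scale (counit h) 1"
begin

section \<open>The algebra \<open>K\<^sup>*(H)\<close>\<close>

text \<open>Only used when the antipode is bijective.\<close>

abbreviation antipode_inv :: "'h \<Rightarrow> 'h" where
  "antipode_inv \<equiv> inv_into UNIV antipode"

definition K_degree :: "nat \<Rightarrow> ('h list \<Rightarrow>\<^sub>0 'k) set set" where
  "K_degree n = tensor_power (Suc n)"

text \<open>With 0-based indexing, the word \<open>z\<close> in the following product stands for
  \<open>x\<^sup>n\<^bsub>(1)\<^esub> \<otimes> \<dots> \<otimes> x\<^sup>n\<^bsub>(2m+1)\<^esub>\<close>.\<close>

definition K_mult_word :: "'h list \<Rightarrow> 'h list \<Rightarrow> ('h list \<Rightarrow>\<^sub>0 'k)" where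
  "K_mult_word xs ys =
    (let m = length ys - 1 in
      lin_ext wscale
        (\<lambda>z. word (butlast xs @
                    map (\<lambda>i. z ! i * ys ! i * antipode_inv (z ! (2 * m - i))) [0..<m] @
                    [z ! m * ys ! m]))
        (comult_iter (2 * m) (last xs)))"

definition K_mult ::
  "('h list \<Rightarrow>\<^sub>0 'k) set \<Rightarrow> ('h list \<Rightarrow>\<^sub>0 'k) set \<Rightarrow> ('h list \<Rightarrow>\<^sub>0 'k) set" where
  "K_mult s t =
    (\<Union>p\<in>s. \<Union>q\<in>t. tclass (lin_ext wscale (\<lambda>xs. lin_ext wscale (K_mult_word xs) q) p))"

definition K_diff_word :: "'h list \<Rightarrow> ('h list \<Rightarrow>\<^sub>0 'k)" where
  "K_diff_word hs =
    (let n = length hs - 1 in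
      - word (1 # hs)
      + (\<Sum>j<n. wscale ((- 1) ^ j) (comult_at j hs))
      + wscale ((- 1) ^ n)
          (lin_ext wscale (\<lambda>z. word (butlast hs @ [z ! 0 * antipode_inv (z ! 2), z ! 1]))
            (comult_iter 2 (last hs))))"

definition K_diff :: "('h list \<Rightarrow>\<^sub>0 'k) set \<Rightarrow> ('h list \<Rightarrow>\<^sub>0 'k) set" where
  "K_diff s = (\<Union>p\<in>s. tclass (lin_ext wscale K_diff_word p))"

text \<open>The sum of all \<open>H\<^sup>\<otimes>\<^sup>(\<^sup>n\<^sup>+\<^sup>1\<^sup>)\<close>, \<open>n \<ge> 0\<close>: the nonempty words.\<close>

definition K_algebra :: "('k, ('h list \<Rightarrow>\<^sub>0 'k) set) module" where
  "K_algebra =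
    \<lparr>carrier = words.span (word ` {xs. xs \<noteq> []}) // tensor_eq,
     monoid.mult = K_mult,
     one = tclass (word [1]),
     ring.zero = tclass 0,
     add = tadd,
     module.smult = tscale\<rparr>"

end

end

theory Submission
  imports Defs
begin

text \<open>
  Equality of classes in tensor powers is tested on multilinear scalar forms, so all identities
  become identities between scalar Sweedler sums; the operations are described by their
  transposes on forms. The antipode is an anti-homomorphism of algebras and coalgebras, hence so
  is its inverse. The product with an element \<open>x\<close> of degree 0 satisfies
  \<open>x (y \<otimes> w) = \<Sum> x\<^bsub>(1)\<^esub> y S\<^sup>-\<^sup>1(x\<^bsub>(3)\<^esub>) \<otimes> x\<^bsub>(2)\<^esub> w\<close>, which gives associativity by induction on the length.
  Put \<open>e = 1 \<otimes> 1\<close> in degree 1. Then \<open>d x = \<partial> x - (e x - (-1)\<^sup>n x e)\<close> for \<open>x\<close> of degree \<open>n\<close>, where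
  \<open>\<partial>\<close> is the alternating sum of the comultiplications in all but the last factor. This \<open>\<partial>\<close> is a
  derivation with \<open>\<partial>\<^sup>2 = 0\<close> and \<open>\<partial> e = e\<^sup>2\<close>, so \<open>d\<close> is a derivation with \<open>d\<^sup>2 = 0\<close>.
\<close>

section \<open>Linear extension\<close>

text \<open>\<open>sweedler\<close> picks an arbitrary representative of the comultiplication, so a
  Sweedler sum depends on that choice unless its summand is linear in every leg. Hence the many
  linearity lemmas: they license each use of coassociativity, of the counit and of the antipode.
  Transposes compose in the opposite order, so \<open>kmul (kdiff \<phi>) xs ys\<close> is the value
  of \<phi> on d(x y). The element e is read off from the formula for d: prepending 1 is the product
  e x, and the term with three legs of the last factor is the product x e. The graded commutator
  with e is a derivation, which gives the Leibniz rule. The square of \<partial> minus this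
  commutator is minus the commutator with \<partial> e - e^2, so \<partial> e = e^2 is the
  Maurer-Cartan equation that makes it vanish. The inverse antipode enters through two properties:
  reversal of products gives associativity (\<open>act_mult\<close>), reversal of coproducts makes
  \<partial> compatible with products (\<open>act_del\<close>).\<close>

lemma vector_space_field: "vector_space ((*) :: 'k::field \<Rightarrow> 'k \<Rightarrow> 'k)"
  by unfold_locales (auto simp: algebra_simps)

context vector_space
begin

lemma lin_ext_superset:
  assumes "finite A" "Poly_Mapping.keys p \<subseteq> A"
  shows "lin_ext scale f p = (\<Sum>x\<in>A. scale (Poly_Mapping.lookup p x) (f x))"
  unfolding lin_ext_def
  by (rule sum.mono_neutral_left) (use assms in \<open>auto simp: in_keys_iff\<close>)

lemma lin_ext_zero [simp]: "lin_ext scale f 0 = 0"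
  by (simp add: lin_ext_def)

lemma lin_ext_add: "lin_ext scale f (p + q) = lin_ext scale f p + lin_ext scale f q"
proof -
  let ?A = "Poly_Mapping.keys p \<union> Poly_Mapping.keys q"
  have "Poly_Mapping.keys (p + q) \<subseteq> ?A"
    by (rule keys_add)
  then show ?thesis
    by (simp add: lin_ext_superset[of ?A] lookup_add scale_left_distrib sum.distrib)
qed

lemma lin_ext_wscale: "lin_ext scale f (wscale c p) = scale c (lin_ext scale f p)"
proof -
  have "Poly_Mapping.keys (wscale c p) \<subseteq> Poly_Mapping.keys p"
    by (auto simp: in_keys_iff lookup_wscale)
  then show ?thesis
    by (simp add: lin_ext_superset[of "Poly_Mapping.keys p"] lookup_wscale scale_sum_right)
qed

lemma lin_ext_uminus: "lin_ext scale f (- p) = - lin_ext scale f p"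
  by (rule sym, rule minus_unique) (simp flip: lin_ext_add)

lemma lin_ext_diff: "lin_ext scale f (p - q) = lin_ext scale f p - lin_ext scale f q"
  using lin_ext_add[of f p "- q"] by (simp add: lin_ext_uminus)

lemma lin_ext_sum: "lin_ext scale f (\<Sum>i\<in>I. p i) = (\<Sum>i\<in>I. lin_ext scale f (p i))"
  by (induction I rule: infinite_finite_induct) (auto simp: lin_ext_add)

lemma lin_ext_word [simp]: "lin_ext scale f (word xs) = f xs"
  by (simp add: lin_ext_def word_def)

lemma lin_ext_cong:
  assumes "\<And>x. x \<in> Poly_Mapping.keys p \<Longrightarrow> f x = g x"
  shows "lin_ext scale f p = lin_ext scale g p"
  using assms by (simp add: lin_ext_def)

lemma module_hom_lin_ext:
  assumes "Vector_Spaces.linear scale s' L"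
  shows "L (lin_ext scale f p) = lin_ext s' (\<lambda>x. L (f x)) p"
proof -
  interpret L: Vector_Spaces.linear scale s' L
    by (rule assms)
  show ?thesis
    by (simp add: lin_ext_def L.sum L.scale)
qed

lemma linear_lin_ext: "Vector_Spaces.linear wscale scale (lin_ext scale f)"
  by unfold_locales (auto simp: lin_ext_add lin_ext_wscale)

text \<open>A basis of R stays independent when v is added, so a functional may be prescribed as 1
  at v and 0 on that basis.\<close>

lemma separating_functional:
  assumes "subspace R" "v \<notin> R"
  obtains g where "Vector_Spaces.linear scale (*) g" "\<And>r. r \<in> R \<Longrightarrow> g r = 0" "g v \<noteq> 0"
proof -
  obtain B where B: "B \<subseteq> R" "independent B" "R \<subseteq> span B"
    by (rule maximal_independent_subset)
  have "span B = R"
    using B assms(1) by (simp add: span_subspace)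
  then have ind: "independent (insert v B)"
    using assms(2) B(2) by (simp add: independent_insertI)
  interpret vector_space_pair scale "(*) :: 'a \<Rightarrow> 'a \<Rightarrow> 'a"
    by (intro vector_space_pair.intro vector_space_axioms vector_space_field)
  obtain g where g: "Vector_Spaces.linear scale (*) g"
    "\<forall>x\<in>insert v B. g x = (if x = v then 1 else 0)"
    using linear_independent_extend[OF ind, of "\<lambda>x. if x = v then 1 else 0"] by blast
  interpret g: Vector_Spaces.linear scale "(*)" g
    by (rule g(1))
  have "g r = 0" if "r \<in> R" for r
  proof -
    have "\<forall>x\<in>B. g x = 0"
      using g(2) assms(2) B(1) by auto
    with that \<open>span B = R\<close> show ?thesis
      using g.eq_0_on_span[of B r] by simp
  qed
  then show ?thesis
    using g(2) by (intro that[OF g(1)]) auto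
qed

end

lemma lin_ext_word_id: "lin_ext wscale word p = p"
proof (rule poly_mapping_eqI)
  fix x
  have "Poly_Mapping.lookup (lin_ext wscale word p) x =
      (\<Sum>y\<in>Poly_Mapping.keys p. if y = x then Poly_Mapping.lookup p y else 0)"
    unfolding lin_ext_def lookup_sum
    by (intro sum.cong) (auto simp: lookup_wscale word_def lookup_single when_def)
  also have "\<dots> = Poly_Mapping.lookup p x"
    by (simp add: in_keys_iff)
  finally show "Poly_Mapping.lookup (lin_ext wscale word p) x = Poly_Mapping.lookup p x" .
qed

text \<open>Turns membership in the spans that define tensor powers into a condition on supports,
  which \<open>keys_lin_ext\<close> then verifies for linear extensions.\<close>

lemma span_word: "words.span (word ` W) = {p :: 'h list \<Rightarrow>\<^sub>0 'k::field. Poly_Mapping.keys p \<subseteq> W}"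
proof (intro equalityI subsetI)
  fix p :: "'h list \<Rightarrow>\<^sub>0 'k"
  assume "p \<in> words.span (word ` W)"
  then have "\<forall>x. x \<notin> W \<longrightarrow> Poly_Mapping.lookup p x = 0"
    by (induction rule: words.span_induct_alt)
      (auto simp: lookup_add lookup_wscale word_def lookup_single when_def split: if_splits)
  then show "p \<in> {p. Poly_Mapping.keys p \<subseteq> W}"
    by (auto simp: in_keys_iff)
next
  fix p :: "'h list \<Rightarrow>\<^sub>0 'k"
  assume p: "p \<in> {p. Poly_Mapping.keys p \<subseteq> W}"
  have "lin_ext wscale word p \<in> words.span (word ` W)"
    unfolding lin_ext_def
    by (intro words.span_sum words.span_scale words.span_base) (use p in auto)
  then show "p \<in> words.span (word ` W)"
    by (simp only: lin_ext_word_id)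
qed

lemma keys_word [simp]: "Poly_Mapping.keys (word xs :: 'h list \<Rightarrow>\<^sub>0 'k::field) = {xs}"
  by (simp add: word_def)

lemma keys_lin_ext:
  fixes f :: "'a \<Rightarrow> 'h list \<Rightarrow>\<^sub>0 'k::field"
  assumes "\<And>x. x \<in> Poly_Mapping.keys p \<Longrightarrow> Poly_Mapping.keys (f x) \<subseteq> W"
  shows "Poly_Mapping.keys (lin_ext wscale f p) \<subseteq> W"
proof -
  have "lin_ext wscale f p \<in> words.span (word ` W)"
    unfolding lin_ext_def
    by (intro words.span_sum words.span_scale) (use assms in \<open>auto simp: span_word\<close>)
  then show ?thesis
    by (simp add: span_word)
qed

abbreviation ev :: "('a \<Rightarrow> 'k::field) \<Rightarrow> ('a \<Rightarrow>\<^sub>0 'k) \<Rightarrow> 'k" where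
  "ev \<equiv> lin_ext (*)"

lemmas ev_zero [simp] = vector_space.lin_ext_zero[OF vector_space_field]
  and ev_add = vector_space.lin_ext_add[OF vector_space_field]
  and ev_wscale = vector_space.lin_ext_wscale[OF vector_space_field]
  and ev_uminus = vector_space.lin_ext_uminus[OF vector_space_field]
  and ev_diff = vector_space.lin_ext_diff[OF vector_space_field]
  and ev_sum = vector_space.lin_ext_sum[OF vector_space_field]
  and ev_word [simp] = vector_space.lin_ext_word[OF vector_space_field]
  and ev_cong = vector_space.lin_ext_cong[OF vector_space_field]
  and linear_ev = vector_space.linear_lin_ext[OF vector_space_field]

text \<open>The device that moves an operation on words onto forms: pairing \<phi> with the result
  is pairing the transposed form with the argument.\<close>

lemma ev_lin_ext: "ev \<phi> (lin_ext wscale f p) = ev (\<lambda>x. ev \<phi> (f x)) p"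
  by (rule words.module_hom_lin_ext[OF linear_ev])

lemma ev_fun_add: "ev (\<lambda>x. f x + g x) p = ev f p + ev g p"
  by (simp add: lin_ext_def algebra_simps sum.distrib)

lemma ev_fun_diff: "ev (\<lambda>x. f x - g x) p = ev f p - ev g p"
  by (simp add: lin_ext_def algebra_simps sum_subtractf)

lemma ev_fun_uminus: "ev (\<lambda>x. - f x) p = - ev f p"
  by (simp add: lin_ext_def sum_negf)

lemma ev_fun_mult: "ev (\<lambda>x. c * f x) p = c * ev f p"
  by (simp add: lin_ext_def sum_distrib_left mult_ac)

lemma ev_fun_zero: "ev (\<lambda>x. 0) p = 0"
  by (simp add: lin_ext_def)

lemma ev_swap: "ev (\<lambda>x. ev (\<lambda>y. f x y) q) p = ev (\<lambda>y. ev (\<lambda>x. f x y) p) q"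
  by (simp add: lin_ext_def sum_distrib_left mult_ac) (rule sum.swap)

lemmas ev_fun_simps = ev_fun_add ev_fun_diff ev_fun_uminus ev_fun_mult ev_fun_zero

section \<open>Multilinear forms detect the tensor relations\<close>

context tensor_space
begin

definition linear_form :: "('h \<Rightarrow> 'k) \<Rightarrow> bool" where
  "linear_form f \<longleftrightarrow> (\<forall>x y. f (x + y) = f x + f y) \<and> (\<forall>c x. f (scale c x) = c * f x)"

definition bilinear_form :: "('h \<Rightarrow> 'h \<Rightarrow> 'k) \<Rightarrow> bool" where
  "bilinear_form f \<longleftrightarrow> (\<forall>b. linear_form (\<lambda>a. f a b)) \<and> (\<forall>a. linear_form (f a))"

text \<open>One multilinear map for each length of words, with an unrestricted value at
  \<open>[]\<close>. This matches the quotient, which is taken for all lengths at once.\<close>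

definition multilinear_form :: "('h list \<Rightarrow> 'k) \<Rightarrow> bool" where
  "multilinear_form \<phi> \<longleftrightarrow> (\<forall>us vs. linear_form (\<lambda>x. \<phi> (us @ x # vs)))"

lemma linear_formI:
  "(\<And>x y. f (x + y) = f x + f y) \<Longrightarrow> (\<And>c x. f (scale c x) = c * f x) \<Longrightarrow> linear_form f"
  by (simp add: linear_form_def)

lemma linear_form_add: "linear_form f \<Longrightarrow> f (x + y) = f x + f y"
  and linear_form_scale: "linear_form f \<Longrightarrow> f (scale c x) = c * f x"
  by (simp_all add: linear_form_def)

lemma linear_form_iff: "linear_form f \<longleftrightarrow> Vector_Spaces.linear scale (*) f"
  by (simp add: linear_form_def Vector_Spaces.linear_iff vector_space_axioms vector_space_field)

lemma bilinear_formI: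
  "(\<And>b. linear_form (\<lambda>a. f a b)) \<Longrightarrow> (\<And>a. linear_form (\<lambda>b. f a b)) \<Longrightarrow> bilinear_form f"
  by (simp add: bilinear_form_def)

lemma bilinear_formD:
  assumes "bilinear_form f"
  shows "linear_form (\<lambda>a. f a b)" "linear_form (\<lambda>b. f a b)"
  using assms by (auto simp: bilinear_form_def)

text \<open>Functionals separate points, so identities in H itself can also be checked on scalar
  Sweedler sums.\<close>

lemma linear_form_eqI:
  assumes "\<And>f. linear_form f \<Longrightarrow> f x = f y"
  shows "x = y"
proof (rule ccontr)
  assume "x \<noteq> y"
  then have "x - y \<notin> {0}"
    by simp
  then obtain f where f: "Vector_Spaces.linear scale (*) f" "f (x - y) \<noteq> 0"
    by (rule separating_functional[OF subspace_single_0])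
  interpret f: Vector_Spaces.linear scale "(*)" f
    by (rule f(1))
  have "f x = f y"
    using assms f(1) by (simp add: linear_form_iff)
  with f(2) show False
    by (simp add: f.diff)
qed

lemma linear_form_mult_left: "linear_form f \<Longrightarrow> linear_form (\<lambda>x. c * f x)"
  by (simp add: linear_form_def algebra_simps)

lemma linear_form_plus: "linear_form f \<Longrightarrow> linear_form g \<Longrightarrow> linear_form (\<lambda>x. f x + g x)"
  by (simp add: linear_form_def algebra_simps)

lemma linear_form_minus: "linear_form f \<Longrightarrow> linear_form g \<Longrightarrow> linear_form (\<lambda>x. f x - g x)"
  by (simp add: linear_form_def algebra_simps)

text \<open>Linearity is asked only on the support of p, where the lengths of the words are
  known.\<close>

lemma linear_form_ev:
  assumes "\<And>w. w \<in> Poly_Mapping.keys p \<Longrightarrow> linear_form (\<lambda>x. g x w)"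
  shows "linear_form (\<lambda>x. ev (\<lambda>w. g x w) p)"
proof (rule linear_formI)
  fix x y
  have "ev (\<lambda>w. g (x + y) w) p = ev (\<lambda>w. g x w + g y w) p"
    by (intro ev_cong linear_form_add assms)
  then show "ev (\<lambda>w. g (x + y) w) p = ev (\<lambda>w. g x w) p + ev (\<lambda>w. g y w) p"
    by (simp add: ev_fun_add)
next
  fix c x
  have "ev (\<lambda>w. g (scale c x) w) p = ev (\<lambda>w. c * g x w) p"
    by (intro ev_cong linear_form_scale assms)
  then show "ev (\<lambda>w. g (scale c x) w) p = c * ev (\<lambda>w. g x w) p"
    by (simp add: ev_fun_mult)
qed

lemma multilinear_formI:
  "(\<And>us vs. linear_form (\<lambda>x. \<phi> (us @ x # vs))) \<Longrightarrow> multilinear_form \<phi>"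
  by (simp add: multilinear_form_def)

lemma multilinear_formD:
  assumes "multilinear_form \<phi>"
  shows "linear_form (\<lambda>x. \<phi> (us @ x # vs))"
    "linear_form (\<lambda>x. \<phi> (x # vs))"
    "linear_form (\<lambda>x. \<phi> (a # x # vs))"
    "linear_form (\<lambda>x. \<phi> (a # b # x # vs))"
  using assms[unfolded multilinear_form_def, rule_format, of us vs]
    assms[unfolded multilinear_form_def, rule_format, of "[]" vs]
    assms[unfolded multilinear_form_def, rule_format, of "[a]" vs]
    assms[unfolded multilinear_form_def, rule_format, of "[a, b]" vs] by simp_all

lemma multilinear_form_append:
  assumes "multilinear_form \<phi>"
  shows "multilinear_form (\<lambda>w. \<phi> (us @ w))"
proof (rule multilinear_formI)
  fix us' vs
  show "linear_form (\<lambda>x. \<phi> (us @ us' @ x # vs))"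
    using multilinear_formD(1)[OF assms, of "us @ us'" vs] by simp
qed

lemma multilinear_form_Cons:
  "multilinear_form \<phi> \<Longrightarrow> multilinear_form (\<lambda>w. \<phi> (u # w))"
  using multilinear_form_append[of \<phi> "[u]"] by simp

text \<open>Cutting a form off to one length isolates a homogeneous component of a class; this
  yields the uniqueness in the direct sum decomposition.\<close>

lemma multilinear_form_if_length:
  assumes "multilinear_form \<phi>"
  shows "multilinear_form (\<lambda>w. if length w = n then \<phi> w else 0)"
proof (rule multilinear_formI)
  fix us vs
  show "linear_form (\<lambda>x. if length (us @ x # vs) = n then \<phi> (us @ x # vs) else 0)"
    using multilinear_formD(1)[OF assms, of us vs]
    by (cases "Suc (length us + length vs) = n") (auto simp: linear_form_def)
qed

lemma subspace_tensor_relations: "words.subspace tensor_relations"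
  by (simp add: tensor_relations_def)

lemma ev_tensor_relations:
  assumes "multilinear_form \<phi>" "p \<in> tensor_relations"
  shows "ev \<phi> p = 0"
proof -
  interpret L: Vector_Spaces.linear wscale "(*)" "ev \<phi>"
    by (rule linear_ev)
  show ?thesis
    using assms(2) unfolding tensor_relations_def
  proof (rule L.eq_0_on_span[rotated])
    fix q
    assume "q \<in> {word (us @ (x + y) # vs) - word (us @ x # vs) - word (us @ y # vs) | us x y vs. True} \<union>
     {word (us @ scale c x # vs) - wscale c (word (us @ x # vs)) | us c x vs. True}"
    then show "ev \<phi> q = 0"
      using multilinear_formD(1)[OF assms(1)]
      by (auto simp: L.diff L.scale linear_form_def)
  qed
qed

text \<open>A vector outside the relations is separated from them by a functional g. That g kills
  the generating relations says exactly that its restriction to words is multilinear.\<close>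

lemma tensor_relations_iff:
  "p \<in> tensor_relations \<longleftrightarrow> (\<forall>\<phi>. multilinear_form \<phi> \<longrightarrow> ev \<phi> p = 0)"
proof (intro iffI allI impI)
  assume R: "\<forall>\<phi>. multilinear_form \<phi> \<longrightarrow> ev \<phi> p = 0"
  show "p \<in> tensor_relations"
  proof (rule ccontr)
    assume "p \<notin> tensor_relations"
    then obtain g where g: "Vector_Spaces.linear wscale (*) g"
      "\<And>r. r \<in> tensor_relations \<Longrightarrow> g r = 0" "g p \<noteq> 0"
      using words.separating_functional[OF subspace_tensor_relations] by blast
    interpret g: Vector_Spaces.linear wscale "(*)" g
      by (rule g(1))
    have "multilinear_form (\<lambda>w. g (word w))"
    proof (intro multilinear_formI linear_formI)
      fix us vs x y
      have "word (us @ (x + y) # vs) - word (us @ x # vs) - word (us @ y # vs) \<in> tensor_relations"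
        unfolding tensor_relations_def by (rule words.span_base) blast
      from g(2)[OF this]
      show "g (word (us @ (x + y) # vs)) = g (word (us @ x # vs)) + g (word (us @ y # vs))"
        by (simp add: g.diff diff_eq_eq ac_simps)
    next
      fix us vs c x
      have "word (us @ scale c x # vs) - wscale c (word (us @ x # vs)) \<in> tensor_relations"
        unfolding tensor_relations_def by (rule words.span_base) blast
      from g(2)[OF this] show "g (word (us @ scale c x # vs)) = c * g (word (us @ x # vs))"
        by (simp add: g.diff g.scale)
    qed
    then have "ev (\<lambda>w. g (word w)) p = 0"
      using R by blast
    then have "g (lin_ext wscale word p) = 0"
      by (simp add: words.module_hom_lin_ext[OF g(1)])
    with g(3) show False
      by (simp add: lin_ext_word_id)
  qed
qed (auto intro: ev_tensor_relations)

section \<open>Tensor classes and the operations on them\<close>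

lemma equiv_tensor_eq: "equiv UNIV tensor_eq"
proof (rule equivI)
  show "refl tensor_eq"
    by (simp add: refl_on_def tensor_eq_def words.subspace_0 subspace_tensor_relations)
  show "sym tensor_eq"
  proof (rule symI)
    fix p q
    assume "(p, q) \<in> tensor_eq"
    then show "(q, p) \<in> tensor_eq"
      using words.subspace_neg[OF subspace_tensor_relations, of "p - q"]
      by (simp add: tensor_eq_def)
  qed
  show "trans tensor_eq"
  proof (rule transI)
    fix p q r
    assume "(p, q) \<in> tensor_eq" "(q, r) \<in> tensor_eq"
    then show "(p, r) \<in> tensor_eq"
      using words.subspace_add[OF subspace_tensor_relations, of "p - q" "q - r"]
      by (simp add: tensor_eq_def)
  qed
qed simp

lemma tclass_eq_iff_relations: "tclass p = tclass q \<longleftrightarrow> p - q \<in> tensor_relations"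
proof -
  have "tclass p = tclass q \<longleftrightarrow> (p, q) \<in> tensor_eq"
    unfolding tclass_def by (rule eq_equiv_class_iff[OF equiv_tensor_eq UNIV_I UNIV_I])
  also have "\<dots> \<longleftrightarrow> p - q \<in> tensor_relations"
    by (simp add: tensor_eq_def)
  finally show ?thesis .
qed

lemma mem_tclass: "q \<in> tclass p \<longleftrightarrow> tclass q = tclass p"
proof -
  have "q \<in> tclass p \<longleftrightarrow> p - q \<in> tensor_relations"
    by (simp add: tclass_def tensor_eq_def)
  then show ?thesis
    by (metis tclass_eq_iff_relations)
qed

lemma tclass_eq_iff:
  "tclass p = tclass q \<longleftrightarrow> (\<forall>\<phi>. multilinear_form \<phi> \<longrightarrow> ev \<phi> p = ev \<phi> q)"
  by (simp add: tclass_eq_iff_relations tensor_relations_iff ev_diff)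

lemma tclass_self: "p \<in> tclass p"
  by (simp add: mem_tclass)

lemma ev_cong_tclass:
  "tclass p = tclass q \<Longrightarrow> multilinear_form \<phi> \<Longrightarrow> ev \<phi> p = ev \<phi> q"
  by (simp add: tclass_eq_iff)

lemma UN_tclass:
  assumes "\<And>p'. tclass p' = tclass p \<Longrightarrow> tclass (F p') = tclass (F p)"
  shows "(\<Union>p'\<in>tclass p. tclass (F p')) = tclass (F p)"
proof -
  have "(\<Union>p'\<in>tclass p. tclass (F p')) = (\<Union>p'\<in>tclass p. tclass (F p))"
    by (intro SUP_cong refl assms) (simp add: mem_tclass)
  then show ?thesis
    using tclass_self[of p] by auto
qed

lemma UN2_tclass:
  assumes "\<And>p' q'. tclass p' = tclass p \<Longrightarrow> tclass q' = tclass q \<Longrightarrow> tclass (F p' q') = tclass (F p q)"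
  shows "(\<Union>p'\<in>tclass p. \<Union>q'\<in>tclass q. tclass (F p' q')) = tclass (F p q)"
proof -
  have "(\<Union>p'\<in>tclass p. \<Union>q'\<in>tclass q. tclass (F p' q')) = (\<Union>p'\<in>tclass p. \<Union>q'\<in>tclass q. tclass (F p q))"
    by (intro SUP_cong refl assms) (simp_all add: mem_tclass)
  then show ?thesis
    using tclass_self[of p] tclass_self[of q] by auto
qed

lemma tadd_tclass: "tadd (tclass p) (tclass q) = tclass (p + q)"
  unfolding tadd_def by (rule UN2_tclass) (simp add: tclass_eq_iff ev_add)

lemma tscale_tclass: "tscale c (tclass p) = tclass (wscale c p)"
  unfolding tscale_def
  by (rule UN_tclass) (simp add: tclass_eq_iff ev_wscale)

lemma span_quotient: "words.span (word ` W) // tensor_eq = tclass ` {p. Poly_Mapping.keys p \<subseteq> W}"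
  by (auto simp: quotient_def tclass_def span_word)

end

section \<open>Sweedler sums of scalar-valued forms\<close>

context comultiplication
begin

text \<open>The Sweedler sum of f(h1, h2), evaluated on the chosen representative; for bilinear f
  the choice is irrelevant by \<open>sw2_eq_ev\<close>.\<close>

definition sw2 :: "('h \<Rightarrow> 'h \<Rightarrow> 'k) \<Rightarrow> 'h \<Rightarrow> 'k" where
  "sw2 f h = ev (\<lambda>z. f (z ! 0) (z ! 1)) (sweedler h)"

text \<open>Three legs, obtained by splitting the second leg; \<open>sw2_coassoc\<close> compares
  this with splitting the first.\<close>

abbreviation sw3 :: "('h \<Rightarrow> 'h \<Rightarrow> 'h \<Rightarrow> 'k) \<Rightarrow> 'h \<Rightarrow> 'k" where
  "sw3 f h \<equiv> sw2 (\<lambda>a d. sw2 (\<lambda>b c. f a b c) d) h"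

definition trilinear_form :: "('h \<Rightarrow> 'h \<Rightarrow> 'h \<Rightarrow> 'k) \<Rightarrow> bool" where
  "trilinear_form f \<longleftrightarrow> (\<forall>b c. linear_form (\<lambda>a. f a b c)) \<and> (\<forall>a c. linear_form (\<lambda>b. f a b c)) \<and>
    (\<forall>a b. linear_form (\<lambda>c. f a b c))"

lemma comult_representative:
  "\<exists>p. comult h = tclass p \<and> Poly_Mapping.keys p \<subseteq> {xs. length xs = 2}"
  using comult_tensor[of h] by (auto simp: tensor_power_def span_quotient)

lemma sweedler_mem: "sweedler h \<in> comult h \<and> sweedler h \<in> words.span (word ` {xs. length xs = 2})"
  unfolding sweedler_def
  by (rule someI_ex) (use comult_representative[of h] tclass_self in \<open>force simp: span_word\<close>)

lemma tclass_sweedler: "tclass (sweedler h) = comult h"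
  using sweedler_mem[of h] comult_representative[of h] by (auto simp: mem_tclass)

lemma length_sweedler: "z \<in> Poly_Mapping.keys (sweedler h) \<Longrightarrow> length z = 2"
  using sweedler_mem[of h] by (auto simp: span_word)

text \<open>Extension by zero is needed because forms live on words of all lengths, while
  \<open>nth\<close> is meaningful only on words that are long enough.\<close>

lemma multilinear_form_pair:
  assumes "bilinear_form f"
  shows "multilinear_form (\<lambda>w. if length w = 2 then f (w ! 0) (w ! 1) else 0)"
proof (rule multilinear_formI)
  fix us vs :: "'h list"
  have "linear_form (\<lambda>x. f x b)" "linear_form (\<lambda>x. f a x)" for a b
    using bilinear_formD[OF assms] by auto
  then show "linear_form (\<lambda>x. if length (us @ x # vs) = 2
      then f ((us @ x # vs) ! 0) ((us @ x # vs) ! 1) else 0)"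
    by (cases us) (auto simp: linear_form_def nth_append nth_Cons')
qed

lemma multilinear_form_triple:
  assumes "trilinear_form f"
  shows "multilinear_form (\<lambda>w. if length w = 3 then f (w ! 0) (w ! 1) (w ! 2) else 0)"
proof (rule multilinear_formI)
  fix us vs :: "'h list"
  have lin: "linear_form (\<lambda>x. f x b c)" "linear_form (\<lambda>x. f a x c)" "linear_form (\<lambda>x. f a b x)"
    for a b c
    using assms by (auto simp: trilinear_form_def)
  consider "us = []" | u where "us = [u]" | u v where "us = [u, v]" | "length us > 2"
    by (cases us; cases "tl us"; cases "tl (tl us)") auto
  then show "linear_form (\<lambda>x. if length (us @ x # vs) = 3
      then f ((us @ x # vs) ! 0) ((us @ x # vs) ! 1) ((us @ x # vs) ! 2) else 0)"
    by cases (use lin in \<open>auto simp: linear_form_def nth_append nth_Cons'\<close>)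
qed

lemma sw2_eq_ev:
  assumes "bilinear_form f" "comult h = tclass p" "Poly_Mapping.keys p \<subseteq> {xs. length xs = 2}"
  shows "sw2 f h = ev (\<lambda>z. f (z ! 0) (z ! 1)) p"
proof -
  let ?\<phi> = "\<lambda>w. if length w = 2 then f (w ! 0) (w ! 1) else 0"
  have "sw2 f h = ev ?\<phi> (sweedler h)"
    unfolding sw2_def by (rule ev_cong) (simp add: length_sweedler)
  also have "\<dots> = ev ?\<phi> p"
    by (rule ev_cong_tclass[OF _ multilinear_form_pair[OF assms(1)]])
      (simp add: tclass_sweedler assms(2))
  also have "\<dots> = ev (\<lambda>z. f (z ! 0) (z ! 1)) p"
    by (rule ev_cong) (use assms(3) in auto)
  finally show ?thesis .
qed

lemma sw2_fun_add: "sw2 (\<lambda>a b. f a b + g a b) h = sw2 f h + sw2 g h"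
  and sw2_fun_diff: "sw2 (\<lambda>a b. f a b - g a b) h = sw2 f h - sw2 g h"
  and sw2_fun_mult: "sw2 (\<lambda>a b. c * f a b) h = c * sw2 f h"
  by (simp_all add: sw2_def ev_fun_simps)

lemma sw2_cong: "(\<And>a b. f a b = g a b) \<Longrightarrow> sw2 f h = sw2 g h"
  by (simp add: sw2_def)

lemma sw2_swap: "sw2 (\<lambda>a b. sw2 (\<lambda>c d. f a b c d) y) x = sw2 (\<lambda>c d. sw2 (\<lambda>a b. f a b c d) x) y"
  unfolding sw2_def by (rule ev_swap)

lemma sw2_ev_swap: "sw2 (\<lambda>a b. ev (\<lambda>w. f a b w) p) x = ev (\<lambda>w. sw2 (\<lambda>a b. f a b w) x) p"
  unfolding sw2_def by (rule ev_swap)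

lemma sw3_swap:
  "sw3 (\<lambda>a b c. sw3 (\<lambda>a' b' c'. f a b c a' b' c') y) x =
   sw3 (\<lambda>a' b' c'. sw3 (\<lambda>a b c. f a b c a' b' c') x) y"
proof -
  have "sw3 (\<lambda>a b c. sw3 (\<lambda>a' b' c'. f a b c a' b' c') y) x =
      sw2 (\<lambda>a d. sw2 (\<lambda>a' d'. sw2 (\<lambda>b c. sw2 (\<lambda>b' c'. f a b c a' b' c') d') d) y) x"
    by (intro sw2_cong sw2_swap)
  also have "\<dots> = sw2 (\<lambda>a' d'. sw2 (\<lambda>a d. sw2 (\<lambda>b c. sw2 (\<lambda>b' c'. f a b c a' b' c') d') d) x) y"
    by (rule sw2_swap)
  also have "\<dots> = sw2 (\<lambda>a' d'. sw2 (\<lambda>a d. sw2 (\<lambda>b' c'. sw2 (\<lambda>b c. f a b c a' b' c') d) d') x) y"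
    by (intro sw2_cong sw2_swap)
  also have "\<dots> = sw3 (\<lambda>a' b' c'. sw3 (\<lambda>a b c. f a b c a' b' c') x) y"
    by (intro sw2_cong sw2_swap)
  finally show ?thesis .
qed

text \<open>\<open>sweedler\<close> itself need not be additive. But the sum of the representatives
  of x and y represents the comultiplication of x + y, and a bilinear f sees only the class.\<close>

lemma linear_form_sw2:
  assumes "bilinear_form f"
  shows "linear_form (sw2 f)"
proof (rule linear_formI)
  fix x y
  have "comult (x + y) = tclass (sweedler x + sweedler y)"
    by (simp only: comult_add tclass_sweedler flip: tadd_tclass)
  moreover have "Poly_Mapping.keys (sweedler x + sweedler y) \<subseteq> {xs. length xs = 2}"
    using keys_add[of "sweedler x" "sweedler y"] by (auto dest!: length_sweedler)
  ultimately show "sw2 f (x + y) = sw2 f x + sw2 f y"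
    by (subst sw2_eq_ev[OF assms]) (auto simp: ev_add sw2_def)
next
  fix c x
  have "comult (scale c x) = tclass (wscale c (sweedler x))"
    by (simp only: comult_scale tclass_sweedler flip: tscale_tclass)
  moreover have "Poly_Mapping.keys (wscale c (sweedler x)) \<subseteq> {xs. length xs = 2}"
    by (auto simp: in_keys_iff lookup_wscale intro!: length_sweedler[of _ x])
  ultimately show "sw2 f (scale c x) = c * sw2 f x"
    by (subst sw2_eq_ev[OF assms]) (auto simp: ev_wscale sw2_def)
qed

lemma linear_form_sw2_param:
  assumes "\<And>a b. linear_form (\<lambda>x. f a b x)"
  shows "linear_form (\<lambda>x. sw2 (\<lambda>a b. f a b x) h)"
  using assms unfolding sw2_def by (intro linear_form_ev)

lemma trilinear_formI:
  assumes "\<And>b c. linear_form (\<lambda>a. f a b c)" "\<And>a c. linear_form (\<lambda>b. f a b c)"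
    "\<And>a b. linear_form (\<lambda>c. f a b c)"
  shows "trilinear_form f"
  using assms by (simp add: trilinear_form_def)

lemma trilinear_formD:
  assumes "trilinear_form f"
  shows "linear_form (\<lambda>a. f a b c)" "linear_form (\<lambda>b. f a b c)" "linear_form (\<lambda>c. f a b c)"
  using assms by (simp_all add: trilinear_form_def)

lemma bilinear_form_sw2:
  assumes "trilinear_form f"
  shows "bilinear_form (\<lambda>a d. sw2 (\<lambda>b c. f a b c) d)"
    and "bilinear_form (\<lambda>d c. sw2 (\<lambda>a b. f a b c) d)"
  using trilinear_formD[OF assms]
  by (auto intro!: bilinear_formI linear_form_sw2 linear_form_sw2_param)

lemma linear_form_sw3: "trilinear_form f \<Longrightarrow> linear_form (sw3 f)"
  by (intro linear_form_sw2 bilinear_form_sw2)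

lemma ev_comult_at:
  "ev \<phi> (comult_at j xs) = sw2 (\<lambda>a b. \<phi> (take j xs @ [a, b] @ drop (Suc j) xs)) (xs ! j)"
proof -
  have "z @ ys = z ! 0 # z ! 1 # ys" if "z \<in> Poly_Mapping.keys (sweedler (xs ! j))" for z ys
    using length_sweedler[OF that] by (auto simp: length_Suc_conv numeral_2_eq_2)
  then show ?thesis
    unfolding comult_at_def ev_lin_ext sw2_def
    by (intro ev_cong) simp
qed

end

context coalgebra
begin

lemma sw2_coassoc:
  assumes "trilinear_form f"
  shows "sw2 (\<lambda>d c. sw2 (\<lambda>a b. f a b c) d) h = sw3 f h"
proof -
  let ?\<phi> = "\<lambda>w. if length w = 3 then f (w ! 0) (w ! 1) (w ! 2) else 0"
  have "sw2 (\<lambda>d c. sw2 (\<lambda>a b. f a b c) d) h = ev ?\<phi> (lin_ext wscale (comult_at 0) (sweedler h))"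
    unfolding ev_lin_ext ev_comult_at sw2_def
    by (intro ev_cong) (auto dest!: length_sweedler simp: length_Suc_conv numeral_2_eq_2)
  also have "\<dots> = ev ?\<phi> (lin_ext wscale (comult_at 1) (sweedler h))"
    by (rule ev_cong_tclass[OF coassoc multilinear_form_triple[OF assms]])
  also have "\<dots> = sw3 f h"
    unfolding ev_lin_ext ev_comult_at sw2_def
    by (intro ev_cong) (auto dest!: length_sweedler simp: length_Suc_conv numeral_2_eq_2)
  finally show ?thesis .
qed

lemma sw2_counit:
  assumes "linear_form f"
  shows "sw2 (\<lambda>a b. counit a * f b) h = f h" "sw2 (\<lambda>a b. counit b * f a) h = f h"
proof -
  have f: "f (scale c x) = c * f x" for c x
    using assms by (rule linear_form_scale)
  have L: "Vector_Spaces.linear scale (*) f"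
    using assms by (simp add: linear_form_iff)
  show "sw2 (\<lambda>a b. counit a * f b) h = f h"
    using arg_cong[OF counit_left[of h], of f]
    by (simp add: module_hom_lin_ext[OF L] f sw2_def)
  show "sw2 (\<lambda>a b. counit b * f a) h = f h"
    using arg_cong[OF counit_right[of h], of f]
    by (simp add: module_hom_lin_ext[OF L] f sw2_def)
qed

end

context bialgebra
begin

lemma sw2_one:
  assumes "bilinear_form f"
  shows "sw2 f 1 = f 1 1"
  by (subst sw2_eq_ev[OF assms comult_one]) auto

lemma sw2_mult:
  assumes "bilinear_form f"
  shows "sw2 f (g * h) = sw2 (\<lambda>a b. sw2 (\<lambda>c d. f (a * c) (b * d)) h) g"
proof -
  have "Poly_Mapping.keys (lin_ext wscale (\<lambda>y. lin_ext wscale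
      (\<lambda>z. word [y ! 0 * z ! 0, y ! 1 * z ! 1] :: 'h list \<Rightarrow>\<^sub>0 'k) (sweedler h)) (sweedler g))
      \<subseteq> {xs. length xs = 2}"
    by (intro keys_lin_ext) simp
  then show ?thesis
    by (subst sw2_eq_ev[OF assms comult_mult]) (auto simp: ev_lin_ext sw2_def)
qed

lemma linear_form_mult:
  assumes "linear_form f"
  shows "linear_form (\<lambda>x. f (x * a))" "linear_form (\<lambda>x. f (a * x))"
  using assms
  by (simp_all add: linear_form_def distrib_left distrib_right scale_mult_left scale_mult_right)

lemma sw3_mult:
  assumes "trilinear_form f"
  shows "sw3 f (x * y) = sw3 (\<lambda>a b c. sw3 (\<lambda>a' b' c'. f (a * a') (b * b') (c * c')) y) x"
proof -
  have b: "bilinear_form (f a)" for a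
    using trilinear_formD[OF assms] by (auto intro: bilinear_formI)
  have "sw3 f (x * y) =
      sw2 (\<lambda>a d. sw2 (\<lambda>a' d'. sw2 (\<lambda>b c. f (a * a') b c) (d * d')) y) x"
    by (rule sw2_mult[OF bilinear_form_sw2(1)[OF assms]])
  also have "\<dots> = sw2 (\<lambda>a d. sw2 (\<lambda>a' d'. sw2 (\<lambda>b c. sw2 (\<lambda>b' c'. f (a * a') (b * b') (c * c')) d') d) y) x"
    by (intro sw2_cong sw2_mult b)
  also have "\<dots> = sw3 (\<lambda>a b c. sw3 (\<lambda>a' b' c'. f (a * a') (b * b') (c * c')) y) x"
    by (intro sw2_cong sw2_swap)
  finally show ?thesis .
qed

lemma sw3_one: "trilinear_form f \<Longrightarrow> sw3 f 1 = f 1 1 1"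
  using trilinear_formD[of f]
  by (simp add: sw2_one bilinear_form_sw2 bilinear_formI)

end

section \<open>The antipode is an anti-homomorphism of algebras and coalgebras\<close>

context comultiplication
begin

lemma sw2_add: "bilinear_form f \<Longrightarrow> sw2 f (x + y) = sw2 f x + sw2 f y"
  and sw2_scale: "bilinear_form f \<Longrightarrow> sw2 f (scale c x) = c * sw2 f x"
  by (simp_all add: linear_form_sw2 linear_form_add linear_form_scale)

end

context hopf_algebra
begin

lemma antipode_add: "antipode (x + y) = antipode x + antipode y"
  and antipode_scale: "antipode (scale c x) = scale c (antipode x)"
  using antipode_linear by (auto simp: Vector_Spaces.linear_iff)

lemma counit_add: "counit (x + y) = counit x + counit y"
  and counit_scale: "counit (scale c x) = c * counit x"
  using counit_linear by (auto simp: Vector_Spaces.linear_iff)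

lemmas multilinear_simps = bilinear_form_def trilinear_form_def linear_form_def
  distrib_left distrib_right scale_mult_left scale_mult_right antipode_add antipode_scale
  counit_add counit_scale sw2_fun_add sw2_fun_mult sw2_add sw2_scale mult.left_commute[of _ "_ :: 'k"]

lemma sw2_antipode:
  assumes "linear_form f"
  shows "sw2 (\<lambda>a b. f (antipode a * b)) h = counit h * f 1"
    and "sw2 (\<lambda>a b. f (a * antipode b)) h = counit h * f 1"
proof -
  have f: "f (scale c x) = c * f x" for c x
    using assms by (rule linear_form_scale)
  have L: "Vector_Spaces.linear scale (*) f"
    using assms by (simp add: linear_form_iff)
  show "sw2 (\<lambda>a b. f (antipode a * b)) h = counit h * f 1"
    using arg_cong[OF antipode_left[of h], of f]
    by (simp add: module_hom_lin_ext[OF L] f sw2_def)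
  show "sw2 (\<lambda>a b. f (a * antipode b)) h = counit h * f 1"
    using arg_cong[OF antipode_right[of h], of f]
    by (simp add: module_hom_lin_ext[OF L] f sw2_def)
qed

text \<open>Both anti-homomorphism properties compare a left and a right convolution inverse of
  the same map.\<close>

lemma antipode_mult: "antipode (x * y) = antipode y * antipode x"
proof (rule linear_form_eqI)
  fix f
  assume f: "linear_form f"
  note f_simps = linear_form_add[OF f] linear_form_scale[OF f]
  \<comment> \<open>The triple convolution product, on pairs (x, y), of S(x y), x y and S(y) S(x).
    Collapsing the last two factors leaves the first; collapsing the first two leaves the
    last.\<close>
  define G where "G = (\<lambda>a b c a' b' c'. f (antipode (a * a') * (b * b') * (antipode c' * antipode c)))"
  have "f (antipode (x * y)) = sw3 (\<lambda>a b c. sw3 (\<lambda>a' b' c'. G a b c a' b' c') y) x"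
  proof -
    have "sw2 (\<lambda>b' c'. G a b c a' b' c') d' = counit d' * f (antipode (a * a') * b * antipode c)"
      for a b c a' d'
      using sw2_antipode(2)[of "\<lambda>u. f (antipode (a * a') * b * u * antipode c)" d']
      by (simp add: G_def mult.assoc multilinear_simps f_simps)
    moreover have "sw2 (\<lambda>a' d'. counit d' * f (antipode (a * a') * b * antipode c)) y =
        f (antipode (a * y) * b * antipode c)" for a b c
      by (rule sw2_counit(2)) (simp add: multilinear_simps f_simps)
    moreover have "sw2 (\<lambda>b c. f (antipode (a * y) * b * antipode c)) d =
        counit d * f (antipode (a * y))" for a d
      using sw2_antipode(2)[of "\<lambda>u. f (antipode (a * y) * u)" d]
      by (simp add: mult.assoc multilinear_simps f_simps)
    moreover have "sw2 (\<lambda>a d. counit d * f (antipode (a * y))) x = f (antipode (x * y))"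
      by (rule sw2_counit(2)) (simp add: multilinear_simps f_simps)
    ultimately show ?thesis
      by simp
  qed
  also have "\<dots> = sw3 (\<lambda>a b c. sw2 (\<lambda>e' c'. sw2 (\<lambda>a' b'. G a b c a' b' c') e') y) x"
    by (intro sw2_cong sw2_coassoc[symmetric]) (simp add: G_def multilinear_simps f_simps)
  also have "\<dots> = sw2 (\<lambda>e c. sw2 (\<lambda>a b. sw2 (\<lambda>e' c'. sw2 (\<lambda>a' b'. G a b c a' b' c') e') y) e) x"
    by (intro sw2_coassoc[symmetric]) (simp add: G_def multilinear_simps f_simps)
  also have "\<dots> = sw2 (\<lambda>e c. sw2 (\<lambda>e' c'. sw2 (\<lambda>a b. sw2 (\<lambda>a' b'. G a b c a' b' c') e') e) y) x"
    by (intro sw2_cong sw2_swap)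
  also have "\<dots> = sw2 (\<lambda>e c. sw2 (\<lambda>e' c'. counit e * (counit e' * f (antipode c' * antipode c))) y) x"
  proof (intro sw2_cong)
    fix e c e' c'
    \<comment> \<open>Multiplicativity of the comultiplication merges the two sums into one over the
      legs of \<open>e * e'\<close>, to which the antipode identity applies.\<close>
    have "sw2 (\<lambda>a b. sw2 (\<lambda>a' b'. G a b c a' b' c') e') e =
        sw2 (\<lambda>p q. f (antipode p * q * (antipode c' * antipode c))) (e * e')"
      unfolding G_def by (rule sw2_mult[symmetric]) (simp add: multilinear_simps f_simps)
    also have "\<dots> = counit (e * e') * f (1 * (antipode c' * antipode c))"
      by (rule sw2_antipode(1)) (simp add: multilinear_simps f_simps)
    finally show "sw2 (\<lambda>a b. sw2 (\<lambda>a' b'. G a b c a' b' c') e') e =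
        counit e * (counit e' * f (antipode c' * antipode c))"
      by (simp add: counit_mult)
  qed
  also have "\<dots> = sw2 (\<lambda>e c. counit e * f (antipode y * antipode c)) x"
    by (intro sw2_cong)
      (subst sw2_fun_mult, subst sw2_counit(1), simp_all add: multilinear_simps f_simps)
  also have "\<dots> = f (antipode y * antipode x)"
    by (rule sw2_counit(1)) (simp add: multilinear_simps f_simps)
  finally show "f (antipode (x * y)) = f (antipode y * antipode x)" .
qed

lemma antipode_one: "antipode 1 = 1"
proof (rule linear_form_eqI)
  fix f
  assume f: "linear_form f"
  have "bilinear_form (\<lambda>a b. f (antipode a * b))"
    by (simp add: multilinear_simps linear_form_add[OF f] linear_form_scale[OF f])
  from sw2_one[OF this] show "f (antipode 1) = f 1"
    using sw2_antipode(1)[OF f, of 1] by (simp add: counit_one)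
qed

lemma sw2_antipode_arg:
  assumes "bilinear_form f"
  shows "sw2 f (antipode x) = sw2 (\<lambda>a b. f (antipode b) (antipode a)) x"
proof -
  note f_simps = bilinear_formD[OF assms, THEN linear_form_add]
    bilinear_formD[OF assms, THEN linear_form_scale]
  \<comment> \<open>The same argument with values in H \<otimes> H: \<open>U a b c\<close> pairs f
    with the product of \<Delta>(S(a)), \<Delta>(b) and S(c2) \<otimes> S(c1).\<close>
  define Y where "Y = (\<lambda>p p' q q' r r'. f (p * q * antipode r') (p' * q' * antipode r))"
  define U where "U = (\<lambda>a b c. sw2 (\<lambda>p p'. sw2 (\<lambda>q q'. sw2 (\<lambda>r r'. Y p p' q q' r r') c) b) (antipode a))"
  have "sw2 f (antipode x) = sw2 (\<lambda>a d. counit d * sw2 f (antipode a)) x"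
    by (rule sw2_counit(2)[symmetric]) (simp add: multilinear_simps f_simps)
  also have "\<dots> = sw3 U x"
  proof (rule sw2_cong)
    fix a d
    \<comment> \<open>With d split into d1, ..., d4 the two slots contain d1 S(d4) and d2 S(d3). The
      inner pair collapses first, which makes the outer pair adjacent.\<close>
    have Y: "sw2 (\<lambda>b c. sw2 (\<lambda>q q'. sw2 (\<lambda>r r'. Y p p' q q' r r') c) b) d = counit d * f p p'"
      for p p'
    proof -
      have "sw2 (\<lambda>b c. sw2 (\<lambda>q q'. sw2 (\<lambda>r r'. Y p p' q q' r r') c) b) d =
          sw3 (\<lambda>q q' c. sw2 (\<lambda>r r'. Y p p' q q' r r') c) d"
        by (rule sw2_coassoc) (simp add: Y_def multilinear_simps f_simps)
      also have "\<dots> = sw2 (\<lambda>q e. sw2 (\<lambda>s r'. sw2 (\<lambda>q' r. Y p p' q q' r r') s) e) d"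
        by (intro sw2_cong sw2_coassoc[symmetric]) (simp add: Y_def multilinear_simps f_simps)
      also have "\<dots> = sw2 (\<lambda>q e. sw2 (\<lambda>s r'. counit s * f (p * q * antipode r') p') e) d"
      proof (intro sw2_cong)
        fix q e s r'
        show "sw2 (\<lambda>q' r. Y p p' q q' r r') s = counit s * f (p * q * antipode r') p'"
          using sw2_antipode(2)[of "\<lambda>u. f (p * q * antipode r') (p' * u)" s]
          by (simp add: Y_def multilinear_simps f_simps mult.assoc)
      qed
      also have "\<dots> = sw2 (\<lambda>q e. f (p * q * antipode e) p') d"
        by (intro sw2_cong sw2_counit(1)) (simp add: multilinear_simps f_simps)
      also have "\<dots> = counit d * f p p'"
        using sw2_antipode(2)[of "\<lambda>u. f (p * u) p'" d]
        by (simp add: multilinear_simps f_simps mult.assoc)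
      finally show ?thesis .
    qed
    have "sw2 (\<lambda>b c. U a b c) d =
        sw2 (\<lambda>p p'. sw2 (\<lambda>b c. sw2 (\<lambda>q q'. sw2 (\<lambda>r r'. Y p p' q q' r r') c) b) d) (antipode a)"
      unfolding U_def by (rule sw2_swap)
    then show "counit d * sw2 f (antipode a) = sw2 (\<lambda>b c. U a b c) d"
      by (simp add: Y sw2_fun_mult)
  qed
  also have "\<dots> = sw2 (\<lambda>d c. sw2 (\<lambda>a b. U a b c) d) x"
    by (rule sw2_coassoc[symmetric]) (simp add: U_def Y_def multilinear_simps f_simps)
  also have "\<dots> = sw2 (\<lambda>d c. counit d * sw2 (\<lambda>r r'. f (antipode r') (antipode r)) c) x"
  proof (intro sw2_cong)
    fix d c
    define g where "g = (\<lambda>p p'. sw2 (\<lambda>r r'. f (p * antipode r') (p' * antipode r)) c)"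
    have g: "bilinear_form g"
      by (simp add: g_def multilinear_simps f_simps)
    \<comment> \<open>The product of \<Delta>(S(a)) and \<Delta>(b) is \<Delta>(S(a) b), so the
      first two factors collapse to \<Delta>(1).\<close>
    have "U a b c = sw2 g (antipode a * b)" for a b
      unfolding U_def Y_def by (subst sw2_mult[OF g]) (simp add: g_def)
    then have "sw2 (\<lambda>a b. U a b c) d = counit d * sw2 g 1"
      using sw2_antipode(1)[OF linear_form_sw2[OF g]] by simp
    then show "sw2 (\<lambda>a b. U a b c) d = counit d * sw2 (\<lambda>r r'. f (antipode r') (antipode r)) c"
      by (simp add: sw2_one[OF g]) (simp add: g_def)
  qed
  also have "\<dots> = sw2 (\<lambda>a b. f (antipode b) (antipode a)) x"
    by (rule sw2_counit(1)) (simp add: multilinear_simps f_simps)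
  finally show ?thesis .
qed

end

locale bijective_hopf_algebra = hopf_algebra scale comult counit antipode
  for scale :: "'k::field \<Rightarrow> 'h::ring_1 \<Rightarrow> 'h" and comult and counit and antipode +
  assumes bij_antipode: "bij antipode"
begin

lemma antipode_inv_antipode [simp]: "antipode_inv (antipode x) = x"
  and antipode_antipode_inv [simp]: "antipode (antipode_inv x) = x"
  using bij_antipode by (auto simp: bij_is_inj bij_is_surj surj_f_inv_f)

lemma antipode_inv_eqI: "antipode y = x \<Longrightarrow> antipode_inv x = y"
  by auto

lemma antipode_inv_add: "antipode_inv (x + y) = antipode_inv x + antipode_inv y"
  and antipode_inv_scale: "antipode_inv (scale c x) = scale c (antipode_inv x)"
  and antipode_inv_mult: "antipode_inv (x * y) = antipode_inv y * antipode_inv x"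
  and antipode_inv_one: "antipode_inv 1 = 1"
  by (rule antipode_inv_eqI, simp add: antipode_add antipode_scale antipode_mult antipode_one)+

text \<open>Follows from \<open>sw2_antipode_arg\<close> at S^-1(x), applied to the flipped form
  with S^-1 in both slots.\<close>

lemma sw2_antipode_inv:
  assumes "bilinear_form f"
  shows "sw2 f (antipode_inv x) = sw2 (\<lambda>a b. f (antipode_inv b) (antipode_inv a)) x"
proof -
  have "bilinear_form (\<lambda>a b. f (antipode_inv b) (antipode_inv a))"
    using assms by (simp add: bilinear_form_def linear_form_def antipode_inv_add antipode_inv_scale)
  from sw2_antipode_arg[OF this, of "antipode_inv x"] show ?thesis
    by simp
qed

end

section \<open>Iterated comultiplication\<close>

context comultiplication
begin

text \<open>The product formula reads legs by position, so as a function of the word of legs it is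
  multilinear only at the one correct length; \<open>multilinear_form\<close> would be too
  strong.\<close>

definition multilinear_on_length :: "nat \<Rightarrow> ('h list \<Rightarrow> 'k) \<Rightarrow> bool" where
  "multilinear_on_length n f \<longleftrightarrow>
    (\<forall>us vs. length us + length vs + 1 = n \<longrightarrow> linear_form (\<lambda>x. f (us @ x # vs)))"

lemma multilinear_on_lengthD:
  "multilinear_on_length n f \<Longrightarrow> length us + length vs + 1 = n \<Longrightarrow> linear_form (\<lambda>x. f (us @ x # vs))"
  by (simp add: multilinear_on_length_def)

lemma multilinear_on_length_Cons:
  assumes "multilinear_on_length (Suc n) f"
  shows "multilinear_on_length n (\<lambda>z. f (a # z))"
  unfolding multilinear_on_length_def
  using multilinear_on_lengthD[OF assms, of "a # _"] by simp

lemma multilinear_on_length_snoc: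
  assumes "multilinear_on_length (Suc n) f"
  shows "multilinear_on_length n (\<lambda>z. f (z @ [a]))"
  unfolding multilinear_on_length_def
  using multilinear_on_lengthD[OF assms, of _ "_ @ [a]"] by simp

lemma multilinear_on_length_hd:
  "multilinear_on_length (Suc n) f \<Longrightarrow> length vs = n \<Longrightarrow> linear_form (\<lambda>x. f (x # vs))"
  using multilinear_on_lengthD[of _ f "[]"] by simp

lemma multilinear_on_length_last:
  "multilinear_on_length (Suc n) f \<Longrightarrow> length us = n \<Longrightarrow> linear_form (\<lambda>x. f (us @ [x]))"
  using multilinear_on_lengthD[of _ f us "[]"] by simp

lemma length_comult_iter: "z \<in> Poly_Mapping.keys (comult_iter r h) \<Longrightarrow> length z = Suc r"
proof (induction r arbitrary: z)
  case (Suc r)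
  have "Poly_Mapping.keys (comult_iter (Suc r) h) \<subseteq> {z. length z = Suc (Suc r)}"
    unfolding comult_iter.simps comult_at_def
    by (intro keys_lin_ext) (auto dest!: length_sweedler Suc.IH)
  with Suc.prems show ?case
    by auto
qed simp

lemma ev_comult_iter_Suc:
  "ev f (comult_iter (Suc r) h) = ev (\<lambda>z. sw2 (\<lambda>a b. f (a # b # tl z)) (hd z)) (comult_iter r h)"
  unfolding comult_iter.simps ev_lin_ext ev_comult_at
  by (intro ev_cong) (auto dest!: length_comult_iter simp: hd_conv_nth length_Suc_conv)

text \<open>\<open>comult_iter\<close> always splits the first leg, so the last leg comes from the
  very first comultiplication and all later ones act on its left leg.\<close>

lemma ev_comult_iter_snoc:
  "ev f (comult_iter (Suc r) h) = sw2 (\<lambda>a b. ev (\<lambda>z. f (z @ [b])) (comult_iter r a)) h"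
proof (induction r arbitrary: f h)
  case 0
  then show ?case
    by (simp only: ev_comult_iter_Suc) simp
next
  case (Suc r)
  have "ev f (comult_iter (Suc (Suc r)) h) = sw2 (\<lambda>a b. ev (\<lambda>z.
      sw2 (\<lambda>p q. f (p # q # tl (z @ [b]))) (hd (z @ [b]))) (comult_iter r a)) h"
    by (subst ev_comult_iter_Suc) (rule Suc.IH)
  also have "\<dots> = sw2 (\<lambda>a b. ev (\<lambda>z. sw2 (\<lambda>p q. f ((p # q # tl z) @ [b])) (hd z)) (comult_iter r a)) h"
    by (intro sw2_cong ev_cong) (auto dest!: length_comult_iter simp: length_Suc_conv)
  also have "\<dots> = sw2 (\<lambda>a b. ev (\<lambda>z. f (z @ [b])) (comult_iter (Suc r) a)) h"
    by (simp only: ev_comult_iter_Suc)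
  finally show ?case .
qed

lemma linear_form_ev_comult_iter:
  "multilinear_on_length (Suc r) f \<Longrightarrow> linear_form (\<lambda>h. ev f (comult_iter r h))"
proof (induction r arbitrary: f)
  case 0
  then show ?case
    using multilinear_on_length_hd[OF 0, of "[]"] by simp
next
  case (Suc r)
  show ?case
    unfolding ev_comult_iter_snoc
    by (intro linear_form_sw2 bilinear_formI Suc.IH linear_form_ev
        multilinear_on_length_snoc[OF Suc.prems] multilinear_on_length_last[OF Suc.prems])
      (rule length_comult_iter)
qed

end

context coalgebra
begin

text \<open>The last leg is peeled off by \<open>ev_comult_iter_snoc\<close>, the induction
  hypothesis peels off the first leg of the rest, and coassociativity exchanges the two
  comultiplications.\<close>

lemma ev_comult_iter_Cons:
  "multilinear_on_length (Suc (Suc r)) f \<Longrightarrow>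
    ev f (comult_iter (Suc r) h) = sw2 (\<lambda>a b. ev (\<lambda>z. f (a # z)) (comult_iter r b)) h"
proof (induction r arbitrary: f h)
  case 0
  then show ?case
    by (simp only: ev_comult_iter_Suc) simp
next
  case (Suc r)
  note f = Suc.prems
  have "ev f (comult_iter (Suc (Suc r)) h) =
      sw2 (\<lambda>p q. sw2 (\<lambda>a b. ev (\<lambda>z. f ((a # z) @ [q])) (comult_iter r b)) p) h"
    by (subst ev_comult_iter_snoc) (intro sw2_cong Suc.IH multilinear_on_length_snoc[OF f])
  also have "\<dots> = sw3 (\<lambda>a b q. ev (\<lambda>z. f ((a # z) @ [q])) (comult_iter r b)) h"
  proof (intro sw2_coassoc trilinear_formI)
    fix a b q
    show "linear_form (\<lambda>a. ev (\<lambda>z. f ((a # z) @ [q])) (comult_iter r b))"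
      by (intro linear_form_ev, unfold append_Cons, intro multilinear_on_length_hd[OF f])
        (simp add: length_comult_iter)
    show "linear_form (\<lambda>b. ev (\<lambda>z. f ((a # z) @ [q])) (comult_iter r b))"
      by (intro linear_form_ev_comult_iter multilinear_on_length_Cons
          multilinear_on_length_snoc[OF f])
    show "linear_form (\<lambda>q. ev (\<lambda>z. f ((a # z) @ [q])) (comult_iter r b))"
      by (intro linear_form_ev multilinear_on_length_last[OF f]) (simp add: length_comult_iter)
  qed
  also have "\<dots> = sw2 (\<lambda>a b. ev (\<lambda>z. f (a # z)) (comult_iter (Suc r) b)) h"
    unfolding ev_comult_iter_snoc by simp
  finally show ?case .
qed

text \<open>The two outermost legs are those that surround the first factor of y in the product
  formula; the inner ones form a shorter iterate.\<close>

lemma ev_comult_iter_ends: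
  assumes "multilinear_on_length (Suc (Suc (Suc r))) f"
  shows "ev f (comult_iter (Suc (Suc r)) h) =
    sw3 (\<lambda>a b c. ev (\<lambda>z. f (a # z @ [c])) (comult_iter r b)) h"
  by (subst ev_comult_iter_Cons[OF assms]) (intro sw2_cong ev_comult_iter_snoc)

end

section \<open>The product on forms\<close>

context bijective_hopf_algebra
begin

text \<open>\<open>act \<phi> x ys\<close> is the value of \<open>\<phi>\<close> on the product of \<open>x\<close> in degree 0 with \<open>ys\<close>. Peeling
  off the two outermost legs of the iterated comultiplication of \<open>x\<close> gives a recursion in \<open>ys\<close>.\<close>

fun act :: "('h list \<Rightarrow> 'k) \<Rightarrow> 'h \<Rightarrow> 'h list \<Rightarrow> 'k" where
  "act \<phi> x [] = 0"
| "act \<phi> x [y] = \<phi> [x * y]"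
| "act \<phi> x (y # y' # ys) =
    sw3 (\<lambda>a b c. act (\<lambda>w. \<phi> ((a * y * antipode_inv c) # w)) b (y' # ys)) x"

text \<open>The transpose of the whole product: on nonempty \<open>ys\<close> it is \<phi> paired
  with \<open>K_mult_word xs ys\<close>, see \<open>ev_K_mult_word\<close>.\<close>

definition kmul :: "('h list \<Rightarrow> 'k) \<Rightarrow> 'h list \<Rightarrow> 'h list \<Rightarrow> 'k" where
  "kmul \<phi> xs ys = act (\<lambda>w. \<phi> (butlast xs @ w)) (last xs) ys"

lemma act_Cons:
  "ys \<noteq> [] \<Longrightarrow> act \<phi> x (y # ys) =
    sw3 (\<lambda>a b c. act (\<lambda>w. \<phi> ((a * y * antipode_inv c) # w)) b ys) x"
  by (cases ys) simp_all

text \<open>Only words as long as \<open>ys\<close> are fed to the form, so equations valid for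
  nonempty words, such as \<open>kmul_Cons\<close>, may be applied under \<open>act\<close>.\<close>

lemma act_cong:
  "(\<And>w. length w = length ys \<Longrightarrow> \<phi> w = \<psi> w) \<Longrightarrow> act \<phi> x ys = act \<psi> x ys"
proof (induction ys arbitrary: \<phi> \<psi> x)
  case (Cons y ys)
  show ?case
  proof (cases "ys = []")
    case False
    then show ?thesis
      unfolding act_Cons[OF False] using Cons.prems by (intro sw2_cong Cons.IH) simp
  qed (simp add: Cons.prems)
qed simp

lemma act_fun_add: "act (\<lambda>w. \<phi> w + \<psi> w) x ys = act \<phi> x ys + act \<psi> x ys"
proof (induction ys arbitrary: \<phi> \<psi> x)
  case (Cons y ys)
  show ?case
  proof (cases "ys = []")
    case False
    show ?thesis
      by (simp only: act_Cons[OF False] Cons.IH sw2_fun_add)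
  qed simp
qed simp

lemma act_fun_mult: "act (\<lambda>w. c * \<phi> w) x ys = c * act \<phi> x ys"
proof (induction ys arbitrary: \<phi> x)
  case (Cons y ys)
  show ?case
  proof (cases "ys = []")
    case False
    show ?thesis
      by (simp only: act_Cons[OF False] Cons.IH sw2_fun_mult)
  qed simp
qed simp

lemma act_fun_uminus: "act (\<lambda>w. - \<phi> w) x ys = - act \<phi> x ys"
  using act_fun_mult[of "- 1"] by simp

lemma act_fun_diff: "act (\<lambda>w. \<phi> w - \<psi> w) x ys = act \<phi> x ys - act \<psi> x ys"
  using act_fun_add[of \<phi> "\<lambda>w. - \<psi> w"] by (simp add: act_fun_uminus)

text \<open>\<open>act\<close> is linear in its form, so a sum over an index independent of the word
  can be pulled out. This separates the Sweedler sums of different elements.\<close>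

lemma act_ev: "act (\<lambda>w. ev (\<lambda>v. g v w) p) x ys = ev (\<lambda>v. act (g v) x ys) p"
proof (induction ys arbitrary: g x)
  case (Cons y ys)
  show ?case
  proof (cases "ys = []")
    case False
    show ?thesis
      by (simp only: act_Cons[OF False] Cons.IH sw2_ev_swap)
  qed simp
qed (simp add: ev_fun_zero)

lemma act_sw2: "act (\<lambda>w. sw2 (\<lambda>a b. g a b w) h) x ys = sw2 (\<lambda>a b. act (g a b) x ys) h"
  unfolding sw2_def by (rule act_ev)

lemma linear_form_act_param:
  assumes "\<And>w. linear_form (\<lambda>a. g a w)"
  shows "linear_form (\<lambda>a. act (g a) x ys)"
proof -
  have "g (a + b) = (\<lambda>w. g a w + g b w)" "g (scale c a) = (\<lambda>w. c * g a w)" for a b c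
    using assms by (auto simp: linear_form_def)
  then show ?thesis
    by (simp add: linear_form_def act_fun_add act_fun_mult)
qed

lemma linear_form_conj:
  assumes "linear_form f"
  shows "linear_form (\<lambda>a. f (a * y * c))" "linear_form (\<lambda>y. f (a * y * c))"
    "linear_form (\<lambda>c. f (a * y * antipode_inv c))"
  using assms by (simp_all add: multilinear_simps antipode_inv_add antipode_inv_scale)

text \<open>Linearity in the middle leg is assumed for the shorter word, so that the lemma can serve
  in the inductive proof of \<open>linear_form_act\<close>.\<close>

lemma trilinear_form_act:
  assumes "multilinear_form \<phi>" "\<And>\<psi>. multilinear_form \<psi> \<Longrightarrow> linear_form (\<lambda>b. act \<psi> b ys)"
  shows "trilinear_form (\<lambda>a b c. act (\<lambda>w. \<phi> ((a * y * antipode_inv c) # w)) b ys)"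
proof (rule trilinear_formI)
  fix a b c
  show "linear_form (\<lambda>b. act (\<lambda>w. \<phi> ((a * y * antipode_inv c) # w)) b ys)"
    by (intro assms multilinear_form_Cons)
qed (intro linear_form_act_param linear_form_conj multilinear_formD(2)[OF assms(1)])+

lemma linear_form_act: "multilinear_form \<phi> \<Longrightarrow> linear_form (\<lambda>x. act \<phi> x ys)"
proof (induction ys arbitrary: \<phi>)
  case (Cons y ys)
  show ?case
  proof (cases "ys = []")
    case True
    then show ?thesis
      using linear_form_mult(1)[OF multilinear_formD(2)[OF Cons.prems, of "[]"]] by simp
  next
    case False
    then show ?thesis
      by (simp add: act_Cons) (intro linear_form_sw3 trilinear_form_act Cons)
  qed
qed (simp add: linear_form_def)

lemma multilinear_form_act: "multilinear_form \<phi> \<Longrightarrow> multilinear_form (act \<phi> x)"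
proof (rule multilinear_formI)
  fix us vs
  show "multilinear_form \<phi> \<Longrightarrow> linear_form (\<lambda>u. act \<phi> x (us @ u # vs))"
  proof (induction us arbitrary: \<phi> x)
    case Nil
    show ?case
    proof (cases "vs = []")
      case True
      then show ?thesis
        using linear_form_mult(2)[OF multilinear_formD(2)[OF Nil, of "[]"]] by simp
    next
      case False
      then show ?thesis
        by (simp add: act_Cons)
          (intro linear_form_sw2_param linear_form_act_param linear_form_conj
            multilinear_formD(2)[OF Nil])
    qed
  next
    case (Cons v us)
    then show ?case
      by (simp add: act_Cons) (intro linear_form_sw2_param Cons.IH multilinear_form_Cons)
  qed
qed

lemma act_one:
  "multilinear_form \<phi> \<Longrightarrow> ys \<noteq> [] \<Longrightarrow> act \<phi> 1 ys = \<phi> ys"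
proof (induction ys arbitrary: \<phi>)
  case (Cons y ys)
  show ?case
  proof (cases "ys = []")
    case False
    have "act \<phi> 1 (y # ys) = act (\<lambda>w. \<phi> ((1 * y * antipode_inv 1) # w)) 1 ys"
      unfolding act_Cons[OF False]
      by (rule sw3_one) (intro trilinear_form_act linear_form_act Cons.prems)
    also have "\<dots> = \<phi> (y # ys)"
      using Cons.IH[OF multilinear_form_Cons[OF Cons.prems(1)] False] by (simp add: antipode_inv_one)
    finally show ?thesis .
  qed simp
qed simp

text \<open>The outer legs of x y give a a' z S^-1(c c') = a (a' z S^-1(c')) S^-1(c), which is
  conjugation by the legs of y followed by conjugation by those of x.\<close>

lemma act_mult: "multilinear_form \<phi> \<Longrightarrow> act \<phi> (x * y) zs = act (act \<phi> x) y zs"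
proof (induction zs arbitrary: \<phi> x y)
  case (Cons z zs)
  show ?case
  proof (cases "zs = []")
    case False
    have "act \<phi> (x * y) (z # zs) = sw3 (\<lambda>a b c. sw3 (\<lambda>a' b' c'.
        act (\<lambda>w. \<phi> ((a * a' * z * antipode_inv (c * c')) # w)) (b * b') zs) y) x"
      unfolding act_Cons[OF False]
      by (rule sw3_mult) (intro trilinear_form_act linear_form_act Cons.prems)
    also have "\<dots> = sw3 (\<lambda>a b c. sw3 (\<lambda>a' b' c'. act (\<lambda>w.
        act (\<lambda>v. \<phi> ((a * (a' * z * antipode_inv c') * antipode_inv c) # v)) b w) b' zs) y) x"
      by (intro sw2_cong)
        (simp add: Cons.IH[OF multilinear_form_Cons[OF Cons.prems]] antipode_inv_mult mult.assoc)
    also have "\<dots> = sw3 (\<lambda>a' b' c'. sw3 (\<lambda>a b c. act (\<lambda>w.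
        act (\<lambda>v. \<phi> ((a * (a' * z * antipode_inv c') * antipode_inv c) # v)) b w) b' zs) x) y"
      by (rule sw3_swap)
    also have "\<dots> = sw3 (\<lambda>a' b' c'. act (\<lambda>w. sw3 (\<lambda>a b c.
        act (\<lambda>v. \<phi> ((a * (a' * z * antipode_inv c') * antipode_inv c) # v)) b w) x) b' zs) y"
      by (simp only: act_sw2)
    also have "\<dots> = sw3 (\<lambda>a' b' c'. act (\<lambda>w. act \<phi> x ((a' * z * antipode_inv c') # w)) b' zs) y"
      by (intro sw2_cong act_cong act_Cons[symmetric]) (use False in auto)
    finally show ?thesis
      unfolding act_Cons[OF False] .
  qed (simp add: mult.assoc)
qed simp

section \<open>Products of words of arbitrary degree and their associativity\<close>

lemma kmul_singleton [simp]: "kmul \<phi> [x] ys = act \<phi> x ys"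
  by (simp add: kmul_def)

lemma kmul_append: "w \<noteq> [] \<Longrightarrow> kmul \<phi> (us @ w) ys = kmul (\<lambda>v. \<phi> (us @ v)) w ys"
  by (simp add: kmul_def butlast_append)

lemma kmul_Cons: "xs \<noteq> [] \<Longrightarrow> kmul \<phi> (x # xs) ys = kmul (\<lambda>v. \<phi> (x # v)) xs ys"
  using kmul_append[of xs \<phi> "[x]"] by simp

lemma kmul_cong:
  assumes "xs \<noteq> []" "\<And>w. length w + 1 = length xs + length ys \<Longrightarrow> \<phi> w = \<psi> w"
  shows "kmul \<phi> xs ys = kmul \<psi> xs ys"
  unfolding kmul_def using assms by (intro act_cong assms(2)) auto

lemma kmul_fun_add: "kmul (\<lambda>w. \<phi> w + \<psi> w) xs ys = kmul \<phi> xs ys + kmul \<psi> xs ys"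
  and kmul_fun_mult: "kmul (\<lambda>w. c * \<phi> w) xs ys = c * kmul \<phi> xs ys"
  and kmul_fun_uminus: "kmul (\<lambda>w. - \<phi> w) xs ys = - kmul \<phi> xs ys"
  and kmul_fun_diff: "kmul (\<lambda>w. \<phi> w - \<psi> w) xs ys = kmul \<phi> xs ys - kmul \<psi> xs ys"
  by (simp_all add: kmul_def act_fun_add act_fun_mult act_fun_uminus act_fun_diff)

lemma kmul_ev: "kmul (\<lambda>w. ev (\<lambda>v. g v w) p) xs ys = ev (\<lambda>v. kmul (g v) xs ys) p"
  by (simp add: kmul_def act_ev)

lemma kmul_sw2: "kmul (\<lambda>w. sw2 (\<lambda>a b. g a b w) h) xs ys = sw2 (\<lambda>a b. kmul (g a b) xs ys) h"
  by (simp add: kmul_def act_sw2)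

lemma linear_form_kmul_param:
  "(\<And>w. linear_form (\<lambda>a. g a w)) \<Longrightarrow> linear_form (\<lambda>a. kmul (g a) xs ys)"
  unfolding kmul_def by (rule linear_form_act_param)

lemma multilinear_form_kmul_right: "multilinear_form \<phi> \<Longrightarrow> multilinear_form (kmul \<phi> xs)"
  unfolding kmul_def by (intro multilinear_form_act multilinear_form_append)

lemma multilinear_form_kmul_left:
  assumes "multilinear_form \<phi>"
  shows "multilinear_form (\<lambda>xs. kmul \<phi> xs ys)"
proof (rule multilinear_formI)
  fix us vs
  show "linear_form (\<lambda>x. kmul \<phi> (us @ x # vs) ys)"
  proof (cases "vs = []")
    case True
    then show ?thesis
      by (simp add: kmul_def) (intro linear_form_act multilinear_form_append assms)
  next
    case False
    then show ?thesis
      by (simp add: kmul_append kmul_Cons)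
        (intro linear_form_kmul_param multilinear_formD(1)[OF assms])
  qed
qed

text \<open>This is x (y z) = (x y) z for x of degree 0. The product with z leaves all factors of y
  but the last alone, so they can be peeled off until y has one factor and \<open>act_mult\<close>
  applies.\<close>

lemma act_kmul:
  "multilinear_form \<phi> \<Longrightarrow> ys \<noteq> [] \<Longrightarrow> zs \<noteq> [] \<Longrightarrow>
    act (\<lambda>w. kmul \<phi> w zs) x ys = kmul (act \<phi> x) ys zs"
proof (induction ys arbitrary: \<phi> x)
  case (Cons y ys)
  show ?case
  proof (cases "ys = []")
    case True
    then show ?thesis
      using act_mult[OF Cons.prems(1)] by simp
  next
    case False
    have "act (\<lambda>w. kmul \<phi> w zs) x (y # ys) =
        sw3 (\<lambda>a b c. act (\<lambda>w. kmul (\<lambda>v. \<phi> ((a * y * antipode_inv c) # v)) w zs) b ys) x"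
      unfolding act_Cons[OF False] by (intro sw2_cong act_cong kmul_Cons) (use False in auto)
    also have "\<dots> = sw3 (\<lambda>a b c. kmul (act (\<lambda>v. \<phi> ((a * y * antipode_inv c) # v)) b) ys zs) x"
      by (intro sw2_cong Cons.IH multilinear_form_Cons Cons.prems False)
    also have "\<dots> = kmul (\<lambda>w. sw3 (\<lambda>a b c. act (\<lambda>v. \<phi> ((a * y * antipode_inv c) # v)) b w) x) ys zs"
      by (simp only: kmul_sw2)
    also have "\<dots> = kmul (\<lambda>w. act \<phi> x (y # w)) ys zs"
      by (intro kmul_cong act_Cons[symmetric] False) (use False Cons.prems in \<open>auto simp: neq_Nil_conv length_Suc_conv\<close>)
    finally show ?thesis
      by (simp add: kmul_Cons False)
  qed
qed simp

text \<open>All factors of \<open>xs\<close> but the last are a mere prefix, which is absorbed into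
  the form; the last one is an element of degree 0.\<close>

lemma kmul_assoc:
  assumes "multilinear_form \<phi>" "xs \<noteq> []" "ys \<noteq> []" "zs \<noteq> []"
  shows "kmul (\<lambda>w. kmul \<phi> w zs) xs ys = kmul (kmul \<phi> xs) ys zs"
proof -
  have "kmul (\<lambda>w. kmul \<phi> w zs) xs ys =
      act (\<lambda>w. kmul (\<lambda>v. \<phi> (butlast xs @ v)) w zs) (last xs) ys"
    unfolding kmul_def[of _ xs] by (intro act_cong kmul_append) (use assms in auto)
  also have "\<dots> = kmul (kmul \<phi> xs) ys zs"
    unfolding kmul_def[of \<phi> xs] using assms by (intro act_kmul multilinear_form_append) auto
  finally show ?thesis .
qed

lemma kmul_one_left: "multilinear_form \<phi> \<Longrightarrow> ys \<noteq> [] \<Longrightarrow> kmul \<phi> [1] ys = \<phi> ys"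
  by (simp add: act_one)

lemma kmul_one_right: "xs \<noteq> [] \<Longrightarrow> kmul \<phi> xs [1] = \<phi> xs"
  by (simp add: kmul_def)

end

section \<open>The differential on forms\<close>

context bijective_hopf_algebra
begin

text \<open>\<open>del\<close> and \<open>kdiff\<close> are the transposes of \<open>\<partial>\<close> and \<open>d\<close>; the word \<open>[1, 1]\<close> is \<open>e\<close>.\<close>

fun del :: "('h list \<Rightarrow> 'k) \<Rightarrow> 'h list \<Rightarrow> 'k" where
  "del \<phi> [] = 0"
| "del \<phi> [x] = 0"
| "del \<phi> (x # y # ys) =
    sw2 (\<lambda>a b. \<phi> (a # b # y # ys)) x - del (\<lambda>w. \<phi> (x # w)) (y # ys)"

definition kdiff :: "('h list \<Rightarrow> 'k) \<Rightarrow> 'h list \<Rightarrow> 'k" where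
  "kdiff \<phi> xs =
    - kmul \<phi> [1, 1] xs + del \<phi> xs + (- 1) ^ (length xs - 1) * kmul \<phi> xs [1, 1]"

lemma del_Cons:
  "ys \<noteq> [] \<Longrightarrow> del \<phi> (x # ys) = sw2 (\<lambda>a b. \<phi> (a # b # ys)) x - del (\<lambda>w. \<phi> (x # w)) ys"
  by (cases ys) simp_all

lemma del_cong:
  "(\<And>w. length w = Suc (length ys) \<Longrightarrow> \<phi> w = \<psi> w) \<Longrightarrow> del \<phi> ys = del \<psi> ys"
proof (induction ys arbitrary: \<phi> \<psi>)
  case (Cons y ys)
  show ?case
  proof (cases "ys = []")
    case False
    then show ?thesis
      unfolding del_Cons[OF False] using Cons.prems
      by (intro arg_cong2[where f = "(-)"] sw2_cong Cons.IH) simp_all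
  qed simp
qed simp

lemma del_fun_add: "del (\<lambda>w. \<phi> w + \<psi> w) ys = del \<phi> ys + del \<psi> ys"
proof (induction ys arbitrary: \<phi> \<psi>)
  case (Cons y ys)
  show ?case
  proof (cases "ys = []")
    case False
    show ?thesis
      by (simp only: del_Cons[OF False] Cons.IH sw2_fun_add) simp
  qed simp
qed simp

lemma del_fun_mult: "del (\<lambda>w. c * \<phi> w) ys = c * del \<phi> ys"
proof (induction ys arbitrary: \<phi>)
  case (Cons y ys)
  show ?case
  proof (cases "ys = []")
    case False
    show ?thesis
      by (simp only: del_Cons[OF False] Cons.IH sw2_fun_mult right_diff_distrib)
  qed simp
qed simp

lemma del_fun_uminus: "del (\<lambda>w. - \<phi> w) ys = - del \<phi> ys"
  using del_fun_mult[of "- 1"] by simp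

lemma del_fun_diff: "del (\<lambda>w. \<phi> w - \<psi> w) ys = del \<phi> ys - del \<psi> ys"
  using del_fun_add[of \<phi> "\<lambda>w. - \<psi> w"] by (simp add: del_fun_uminus)

lemma del_ev: "del (\<lambda>w. ev (\<lambda>v. g v w) p) ys = ev (\<lambda>v. del (g v) ys) p"
proof (induction ys arbitrary: g)
  case (Cons y ys)
  show ?case
  proof (cases "ys = []")
    case False
    show ?thesis
      by (simp only: del_Cons[OF False] Cons.IH sw2_ev_swap ev_fun_diff)
  qed (simp add: ev_fun_zero)
qed (simp add: ev_fun_zero)

lemma del_sw2: "del (\<lambda>w. sw2 (\<lambda>a b. g a b w) h) ys = sw2 (\<lambda>a b. del (g a b) ys) h"
  unfolding sw2_def by (rule del_ev)

lemma linear_form_del_param: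
  assumes "\<And>w. linear_form (\<lambda>a. g a w)"
  shows "linear_form (\<lambda>a. del (g a) ys)"
proof -
  have "g (a + b) = (\<lambda>w. g a w + g b w)" "g (scale c a) = (\<lambda>w. c * g a w)" for a b c
    using assms by (auto simp: linear_form_def)
  then show ?thesis
    by (simp add: linear_form_def del_fun_add del_fun_mult)
qed

lemma linear_form_zero: "linear_form (\<lambda>x. 0)"
  by (simp add: linear_form_def)

lemma multilinear_form_del: "multilinear_form \<phi> \<Longrightarrow> multilinear_form (del \<phi>)"
proof (rule multilinear_formI)
  fix us vs
  show "multilinear_form \<phi> \<Longrightarrow> linear_form (\<lambda>u. del \<phi> (us @ u # vs))"
  proof (induction us arbitrary: \<phi>)
    case Nil
    show ?case
    proof (cases "vs = []")
      case False
      then show ?thesis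
        by (simp add: del_Cons)
          (intro linear_form_minus linear_form_sw2 bilinear_formI linear_form_del_param
            multilinear_formD(2,3)[OF Nil])
    qed (simp add: linear_form_zero)
  next
    case (Cons v us)
    show ?case
      using multilinear_formD(1)[OF Cons.prems, of "_ # _ # us"]
      by (simp add: del_Cons)
        (intro linear_form_minus linear_form_sw2_param Cons.IH multilinear_form_Cons Cons.prems)
  qed
qed

text \<open>Both copies are expanded along the first factor. Splitting it twice cancels by
  coassociativity; splitting it once while \<open>del\<close> acts on the rest occurs twice with
  opposite signs; the remainder is inductive.\<close>

lemma del_del: "multilinear_form \<phi> \<Longrightarrow> del (del \<phi>) xs = 0"
proof (induction xs arbitrary: \<phi>)
  case (Cons x xs)
  show ?case
  proof (cases "xs = []")
    case False
    have "sw2 (\<lambda>a b. del \<phi> (a # b # xs)) x =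
        sw2 (\<lambda>a b. sw2 (\<lambda>p q. \<phi> (p # q # b # xs)) a) x - sw3 (\<lambda>a p q. \<phi> (a # p # q # xs)) x
        + sw2 (\<lambda>a b. del (\<lambda>w. \<phi> (a # b # w)) xs) x"
      by (simp add: del_Cons False sw2_fun_diff)
    also have "sw2 (\<lambda>a b. sw2 (\<lambda>p q. \<phi> (p # q # b # xs)) a) x = sw3 (\<lambda>a p q. \<phi> (a # p # q # xs)) x"
      by (intro sw2_coassoc trilinear_formI multilinear_formD[OF Cons.prems])
    finally have 1: "sw2 (\<lambda>a b. del \<phi> (a # b # xs)) x = sw2 (\<lambda>a b. del (\<lambda>w. \<phi> (a # b # w)) xs) x"
      by simp
    have "del (\<lambda>w. del \<phi> (x # w)) xs =
        del (\<lambda>w. sw2 (\<lambda>a b. \<phi> (a # b # w)) x - del (\<lambda>v. \<phi> (x # v)) w) xs"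
      by (intro del_cong del_Cons) auto
    also have "\<dots> = sw2 (\<lambda>a b. del (\<lambda>w. \<phi> (a # b # w)) xs) x"
      by (simp only: del_fun_diff del_sw2 Cons.IH[OF multilinear_form_Cons[OF Cons.prems]] diff_0_right)
    finally show ?thesis
      using 1 by (simp add: del_Cons False)
  qed simp
qed simp

text \<open>The degree 0 case of the derivation property. Comultiplying the conjugated factor gives
  legs of x nested as x1 y1 S^-1(x5) \<otimes> x2 y2 S^-1(x4), with x3 left for the rest: this is
  the action of x on the word in which y is already split.\<close>

lemma act_del: "multilinear_form \<phi> \<Longrightarrow> act (del \<phi>) x ys = del (act \<phi> x) ys"
proof (induction ys arbitrary: \<phi> x)
  case (Cons y ys)
  note \<phi> = Cons.prems
  show ?case
  proof (cases "ys = []")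
    case False
    \<comment> \<open>The summand after y is split into p and q: one new factor carries the legs a,
      c, the other r, s. Both sides become sums of \<open>F\<close> over five legs of x.\<close>
    define F where "F = (\<lambda>a b c p q r s. act (\<lambda>w. \<phi> ((a * p * antipode_inv c) # (r * q * antipode_inv s) # w)) b ys)"
    have lin: "linear_form (\<lambda>a. F a b c p q r s)" "linear_form (\<lambda>b. F a b c p q r s)"
      "linear_form (\<lambda>c. F a b c p q r s)" "linear_form (\<lambda>p. F a b c p q r s)"
      "linear_form (\<lambda>q. F a b c p q r s)" "linear_form (\<lambda>r. F a b c p q r s)"
      "linear_form (\<lambda>s. F a b c p q r s)" for a b c p q r s
      unfolding F_def
      by (intro linear_form_act_param linear_form_act linear_form_conj multilinear_formD(2)[OF \<phi>]
          multilinear_formD(3)[OF \<phi>] linear_form_conj[where f = "\<lambda>u. \<phi> (_ # u # _)"] multilinear_form_Cons \<phi>)+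
    \<comment> \<open>S^-1 reverses coproducts, so a y S^-1(c) has coproduct a1 y1 S^-1(c2)
      \<otimes> a2 y2 S^-1(c1).\<close>
    have comult: "sw2 (\<lambda>p q. act (\<lambda>w. \<phi> (p # q # w)) b ys) (a * y * antipode_inv c) =
        sw2 (\<lambda>r s. sw2 (\<lambda>p q. sw2 (\<lambda>c c'. F r b c' p q s c) c) y) a" for a b c
    proof -
      define g where "g = (\<lambda>p q. act (\<lambda>w. \<phi> (p # q # w)) b ys)"
      have g: "bilinear_form g"
        unfolding g_def
        by (intro bilinear_formI linear_form_act_param multilinear_formD(2,3)[OF \<phi>])
      have g': "bilinear_form (\<lambda>p q. sw2 (\<lambda>c c'. g (p * c) (q * c')) d)" for d
        by (intro bilinear_formI linear_form_sw2_param linear_form_mult bilinear_formD[OF g])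
      have g'': "bilinear_form (\<lambda>c c'. g (u * c) (v * c'))" for u v
        by (intro bilinear_formI linear_form_mult bilinear_formD[OF g])
      show ?thesis
        unfolding g_def[symmetric]
        by (subst sw2_mult[OF g], subst sw2_mult[OF g'], subst sw2_antipode_inv[OF g''])
          (simp add: g_def F_def)
    qed
    have "act (del \<phi>) x (y # ys) = sw3 (\<lambda>a b c. act (\<lambda>w.
        sw2 (\<lambda>p q. \<phi> (p # q # w)) (a * y * antipode_inv c)
        - del (\<lambda>v. \<phi> ((a * y * antipode_inv c) # v)) w) b ys) x"
      unfolding act_Cons[OF False] by (intro sw2_cong act_cong del_Cons) (use False in auto)
    also have "\<dots> = sw3 (\<lambda>a b c. sw2 (\<lambda>p q. act (\<lambda>w. \<phi> (p # q # w)) b ys) (a * y * antipode_inv c)) x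
        - sw3 (\<lambda>a b c. del (act (\<lambda>v. \<phi> ((a * y * antipode_inv c) # v)) b) ys) x"
      by (simp only: act_fun_diff act_sw2 sw2_fun_diff Cons.IH[OF multilinear_form_Cons[OF \<phi>]])
    also have "sw3 (\<lambda>a b c. sw2 (\<lambda>p q. act (\<lambda>w. \<phi> (p # q # w)) b ys) (a * y * antipode_inv c)) x =
        sw2 (\<lambda>p q. act \<phi> x (p # q # ys)) y"
    proof -
      have "sw3 (\<lambda>a b c. sw2 (\<lambda>p q. act (\<lambda>w. \<phi> (p # q # w)) b ys) (a * y * antipode_inv c)) x =
          sw3 (\<lambda>a b c. sw2 (\<lambda>r s. sw2 (\<lambda>p q. sw2 (\<lambda>c c'. F r b c' p q s c) c) y) a) x"
        by (simp only: comult)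
      also have "\<dots> = sw3 (\<lambda>a b c. sw2 (\<lambda>p q. sw2 (\<lambda>r s. sw2 (\<lambda>c c'. F r b c' p q s c) c) a) y) x"
        by (intro sw2_cong sw2_swap)
      also have "\<dots> = sw2 (\<lambda>p q. sw3 (\<lambda>a b c. sw2 (\<lambda>r s. sw2 (\<lambda>c c'. F r b c' p q s c) c) a) x) y"
      proof -
        have "sw3 (\<lambda>a b c. sw2 (\<lambda>p q. sw2 (\<lambda>r s. sw2 (\<lambda>c c'. F r b c' p q s c) c) a) y) x =
          sw2 (\<lambda>a d. sw2 (\<lambda>p q. sw2 (\<lambda>b c. sw2 (\<lambda>r s. sw2 (\<lambda>c c'. F r b c' p q s c) c) a) d) y) x"
          by (intro sw2_cong sw2_swap)
        then show ?thesis
          by (simp only: sw2_swap[of _ x y])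
      qed
      also have "\<dots> = sw2 (\<lambda>p q. act \<phi> x (p # q # ys)) y"
      proof (rule sw2_cong)
        fix p q
        \<comment> \<open>The legs grouped as (r s) b (c c') are regrouped as r (s b c) c', the
          nesting that the recursion of \<open>act\<close> produces for the factors p, q.\<close>
        have "sw3 (\<lambda>a b c. sw2 (\<lambda>r s. sw2 (\<lambda>c c'. F r b c' p q s c) c) a) x =
            sw2 (\<lambda>a d. sw2 (\<lambda>r s. sw3 (\<lambda>b c c'. F r b c' p q s c) d) a) x"
          by (intro sw2_cong sw2_swap)
        also have "\<dots> = sw3 (\<lambda>r s d. sw3 (\<lambda>b c c'. F r b c' p q s c) d) x"
          by (intro sw2_coassoc trilinear_formI linear_form_sw2_param linear_form_sw3 lin)
        also have "\<dots> = sw2 (\<lambda>r t. sw2 (\<lambda>s d. sw2 (\<lambda>b' c'. sw2 (\<lambda>b c. F r b c' p q s c) b') d) t) x"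
          by (intro sw2_cong sw2_coassoc[symmetric] trilinear_formI lin)
        also have "\<dots> = sw2 (\<lambda>r t. sw2 (\<lambda>u c'. sw2 (\<lambda>s b'. sw2 (\<lambda>b c. F r b c' p q s c) b') u) t) x"
          by (intro sw2_cong sw2_coassoc[symmetric] trilinear_formI linear_form_sw2_param linear_form_sw2
              bilinear_formI lin)
        also have "\<dots> = act \<phi> x (p # q # ys)"
          by (simp add: act_Cons False F_def)
        finally show "sw3 (\<lambda>a b c. sw2 (\<lambda>r s. sw2 (\<lambda>c c'. F r b c' p q s c) c) a) x = act \<phi> x (p # q # ys)" .
      qed
      finally show ?thesis .
    qed
    also have "sw3 (\<lambda>a b c. del (act (\<lambda>v. \<phi> ((a * y * antipode_inv c) # v)) b) ys) x =
        del (\<lambda>w. act \<phi> x (y # w)) ys"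
    proof -
      have "del (\<lambda>w. act \<phi> x (y # w)) ys =
          del (\<lambda>w. sw3 (\<lambda>a b c. act (\<lambda>v. \<phi> ((a * y * antipode_inv c) # v)) b w) x) ys"
        by (intro del_cong act_Cons) auto
      then show ?thesis
        by (simp only: del_sw2)
    qed
    finally show ?thesis
      by (simp add: del_Cons False)
  qed simp
qed simp

text \<open>Splitting a factor of \<open>xs\<close> other than the last commutes with the product.
  The last one acts on \<open>ys\<close> and commutes with \<partial> by \<open>act_del\<close>; the
  sign counts the factors passed on the way.\<close>

lemma kmul_del:
  "multilinear_form \<phi> \<Longrightarrow> xs \<noteq> [] \<Longrightarrow> ys \<noteq> [] \<Longrightarrow>
    kmul (del \<phi>) xs ys = del (\<lambda>w. kmul \<phi> w ys) xs + (- 1) ^ (length xs - 1) * del (kmul \<phi> xs) ys"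
proof (induction xs arbitrary: \<phi>)
  case (Cons x xs)
  note \<phi> = Cons.prems(1)
  show ?case
  proof (cases "xs = []")
    case True
    then show ?thesis
      by (simp add: act_del[OF \<phi>])
  next
    case False
    have *: "del (\<lambda>w. kmul \<phi> (x # w) ys) xs = del (\<lambda>w. kmul (\<lambda>v. \<phi> (x # v)) w ys) xs"
      by (intro del_cong kmul_Cons) auto
    have **: "kmul \<phi> (a # b # xs) ys = kmul (\<lambda>w. \<phi> (a # b # w)) xs ys" for a b
      by (simp add: kmul_Cons False)
    have ***: "(- 1) ^ (length (x # xs) - 1) = - ((- 1) ^ (length xs - 1) :: 'k)"
      using False by (cases xs) simp_all
    have "kmul (del \<phi>) (x # xs) ys =
        kmul (\<lambda>w. sw2 (\<lambda>a b. \<phi> (a # b # w)) x - del (\<lambda>v. \<phi> (x # v)) w) xs ys"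
      unfolding kmul_Cons[OF False] by (intro kmul_cong del_Cons False) (use Cons.prems False in \<open>auto simp: neq_Nil_conv length_Suc_conv\<close>)
    also have "\<dots> = sw2 (\<lambda>a b. kmul (\<lambda>w. \<phi> (a # b # w)) xs ys) x - kmul (del (\<lambda>v. \<phi> (x # v))) xs ys"
      by (simp only: kmul_fun_diff kmul_sw2)
    also have "kmul (del (\<lambda>v. \<phi> (x # v))) xs ys = del (\<lambda>w. kmul (\<lambda>v. \<phi> (x # v)) w ys) xs +
        (- 1) ^ (length xs - 1) * del (kmul (\<lambda>v. \<phi> (x # v)) xs) ys"
      by (intro Cons.IH multilinear_form_Cons Cons.prems False)
    also have "kmul (\<lambda>v. \<phi> (x # v)) xs = kmul \<phi> (x # xs)"
      by (rule ext) (simp add: kmul_Cons False)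
    finally show ?thesis
      unfolding del_Cons[OF False] * ** *** by simp
  qed
qed simp

lemma multilinear_form_kdiff:
  assumes "multilinear_form \<phi>"
  shows "multilinear_form (kdiff \<phi>)"
proof -
  note parts = multilinear_form_kmul_right[OF assms, of "[1, 1]"] multilinear_form_del[OF assms]
    multilinear_form_kmul_left[OF assms, of "[1, 1]"]
  show ?thesis
  proof (rule multilinear_formI)
    fix us vs
    have "kdiff \<phi> (us @ x # vs) = (- 1) * kmul \<phi> [1, 1] (us @ x # vs) + del \<phi> (us @ x # vs)
        + (- 1) ^ (length us + length vs) * kmul \<phi> (us @ x # vs) [1, 1]" for x
      by (simp add: kdiff_def)
    then show "linear_form (\<lambda>x. kdiff \<phi> (us @ x # vs))"
      using parts[THEN multilinear_formD(1)]
      by (simp only:) (intro linear_form_plus linear_form_mult_left)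
  qed
qed

text \<open>In (d x) y + (-1)^n x (d y) the two terms x e y cancel; what remains is
  \<open>kmul_del\<close> together with the outer terms of d(x y).\<close>

lemma kmul_kdiff:
  assumes \<phi>: "multilinear_form \<phi>" and xs: "xs \<noteq> []" and ys: "ys \<noteq> []"
  shows "kmul (kdiff \<phi>) xs ys =
    kdiff (\<lambda>w. kmul \<phi> w ys) xs + (- 1) ^ (length xs - 1) * kdiff (kmul \<phi> xs) ys"
proof -
  let ?n = "length xs - 1" and ?m = "length ys - 1"
  \<comment> \<open>All words in the product have degree n + m, so the length-dependent sign in
    \<open>kdiff\<close> is a constant here.\<close>
  have "kmul (kdiff \<phi>) xs ys = kmul (\<lambda>w. - kmul \<phi> [1, 1] w + del \<phi> w +
      (- 1) ^ (?n + ?m) * kmul \<phi> w [1, 1]) xs ys"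
  proof (intro kmul_cong xs)
    fix w :: "'h list"
    assume "length w + 1 = length xs + length ys"
    then have "length w - 1 = ?n + ?m"
      using xs ys by (cases xs; cases ys) auto
    then show "kdiff \<phi> w = - kmul \<phi> [1, 1] w + del \<phi> w + (- 1) ^ (?n + ?m) * kmul \<phi> w [1, 1]"
      by (simp add: kdiff_def)
  qed
  also have "\<dots> = - kmul (kmul \<phi> [1, 1]) xs ys + kmul (del \<phi>) xs ys +
      (- 1) ^ (?n + ?m) * kmul (\<lambda>w. kmul \<phi> w [1, 1]) xs ys"
    by (simp only: kmul_fun_add kmul_fun_uminus kmul_fun_mult)
  finally show ?thesis
    using xs ys
    by (simp add: kdiff_def kmul_del[OF \<phi>] kmul_assoc[OF \<phi>, symmetric] power_add algebra_simps)
qed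

text \<open>d e = -e^2 + \<partial> e - e^2, and \<partial> e = 1 \<otimes> 1 \<otimes> 1 =
  e^2.\<close>

lemma kdiff_unit_pair: "multilinear_form \<phi> \<Longrightarrow> kdiff \<phi> [1, 1] = - kmul \<phi> [1, 1] [1, 1]"
  by (simp add: kdiff_def kmul_Cons act_one multilinear_form_Cons sw2_one bilinear_formI
      multilinear_formD(2,3) del: act.simps)

text \<open>The outer d is applied to each of e x, \<partial> x and x e: the Leibniz rule with d e =
  -e^2 handles the products, \<partial>^2 = 0 the middle term, and everything cancels by
  associativity.\<close>

lemma kdiff_kdiff:
  assumes \<phi>: "multilinear_form \<phi>" and xs: "xs \<noteq> []"
  shows "kdiff (kdiff \<phi>) xs = 0"
proof -
  let ?n = "length xs - 1" and ?e = "[1, 1] :: 'h list"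
  have sgn: "(- 1) ^ ?n * ((- 1) ^ ?n * z) = (z :: 'k)" for z
    by (simp flip: mult.assoc power_add add: mult_2[symmetric])
  \<comment> \<open>The sign is opposite to that of x because \<partial> x has degree n + 1.\<close>
  have "del (kdiff \<phi>) xs = del (\<lambda>w. - kmul \<phi> ?e w + del \<phi> w + - ((- 1) ^ ?n) * kmul \<phi> w ?e) xs"
  proof (intro del_cong)
    fix w :: "'h list"
    assume "length w = Suc (length xs)"
    then have "length w - 1 = Suc ?n"
      using xs by (cases xs) auto
    then show "kdiff \<phi> w = - kmul \<phi> ?e w + del \<phi> w + - ((- 1) ^ ?n) * kmul \<phi> w ?e"
      by (simp add: kdiff_def)
  qed
  also have "\<dots> = - del (kmul \<phi> ?e) xs - (- 1) ^ ?n * del (\<lambda>w. kmul \<phi> w ?e) xs"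
    by (simp only: del_fun_add del_fun_uminus del_fun_mult del_del[OF \<phi>]) simp
  finally have del: "del (kdiff \<phi>) xs = - del (kmul \<phi> ?e) xs - (- 1) ^ ?n * del (\<lambda>w. kmul \<phi> w ?e) xs" .
  have 1: "kmul (kdiff \<phi>) ?e xs = - kmul (\<lambda>w. kmul \<phi> w xs) ?e ?e - kdiff (kmul \<phi> ?e) xs"
    using xs by (simp add: kmul_kdiff[OF \<phi>] kdiff_unit_pair[OF multilinear_form_kmul_left[OF \<phi>]])
  have 2: "kmul (kdiff \<phi>) xs ?e =
      kdiff (\<lambda>w. kmul \<phi> w ?e) xs - (- 1) ^ ?n * kmul (kmul \<phi> xs) ?e ?e"
    using xs by (simp add: kmul_kdiff[OF \<phi>] kdiff_unit_pair[OF multilinear_form_kmul_right[OF \<phi>]])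
  show ?thesis
    unfolding kdiff_def[of "kdiff \<phi>"] 1 2 del unfolding kdiff_def
    using xs by (simp add: kmul_assoc[OF \<phi>, symmetric] algebra_simps sgn)
qed

section \<open>Comparison with the word formulas\<close>

abbreviation mult_word :: "'h list \<Rightarrow> 'h list \<Rightarrow> 'h list" where
  "mult_word ys z \<equiv>
    map (\<lambda>i. z ! i * ys ! i * antipode_inv (z ! (2 * (length ys - 1) - i))) [0..<length ys - 1] @
    [z ! (length ys - 1) * ys ! (length ys - 1)]"

text \<open>Prepending y moves every index, and the centre of the word of legs, up by one, so the
  new outermost legs a and c end up around y.\<close>

lemma mult_word_ends:
  assumes "ys \<noteq> []" "length z = Suc (2 * (length ys - 1))"
  shows "mult_word (y # ys) (a # z @ [c]) = (a * y * antipode_inv c) # mult_word ys z"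
proof -
  obtain m where m: "length ys = Suc m"
    using assms(1) by (cases ys) auto
  have "[0..<Suc m] = 0 # map Suc [0..<m]"
    by (simp add: upt_conv_Cons map_Suc_upt del: upt_Suc)
  \<comment> \<open>The word z has 2 m + 1 legs, so this index never reaches the appended c.\<close>
  moreover have "(z @ [c]) ! (2 * m - j) = z ! (2 * m - j)" for j
    using assms(2) m by (simp add: nth_append less_Suc_eq_le)
  moreover have "Suc (2 * m) - j = Suc (2 * m - j)" if "j < m" for j
    using that by simp
  ultimately show ?thesis
    using assms(2) m by (simp add: nth_append del: upt_Suc)
qed

text \<open>Provides the hypothesis of \<open>ev_comult_iter_ends\<close>. The varying leg is the
  first, the last or an inner one; the outer two lie in the conjugated first factor, the inner ones
  fall under the induction hypothesis.\<close>

lemma multilinear_mult_word: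
  "multilinear_form \<phi> \<Longrightarrow> ys \<noteq> [] \<Longrightarrow>
    multilinear_on_length (Suc (2 * (length ys - 1))) (\<lambda>z. \<phi> (mult_word ys z))"
proof (induction ys arbitrary: \<phi>)
  case (Cons y ys)
  note \<phi> = Cons.prems(1)
  show ?case
  proof (cases "ys = []")
    case True
    then show ?thesis
      using linear_form_mult(1)[OF multilinear_formD(2)[OF \<phi>, of "[]"]]
      by (simp add: multilinear_on_length_def)
  next
    case False
    let ?m = "length ys - 1"
    have len: "length (y # ys) - 1 = Suc ?m"
      using False by (cases ys) auto
    show ?thesis
      unfolding multilinear_on_length_def
    proof (intro allI impI)
      fix us vs :: "'h list"
      assume l: "length us + length vs + 1 = Suc (2 * (length (y # ys) - 1))"
      then have l: "length us + length vs = Suc (Suc (2 * ?m))"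
        unfolding len by simp
      show "linear_form (\<lambda>x. \<phi> (mult_word (y # ys) (us @ x # vs)))"
      proof (cases us)
        case Nil
        then obtain z c where vs: "vs = z @ [c]" "length z = Suc (2 * ?m)"
          using l by (cases vs rule: rev_cases) auto
        have "\<phi> (mult_word (y # ys) (us @ x # vs)) =
            \<phi> ((x * y * antipode_inv c) # mult_word ys z)" for x
          using mult_word_ends[OF False vs(2), where y = y and a = x and c = c] Nil vs by simp
        then show ?thesis
          by (simp only:) (intro linear_form_conj multilinear_formD(2)[OF \<phi>])
      next
        case us: (Cons a us')
        show ?thesis
        proof (cases vs rule: rev_cases)
          case Nil
          then have "length us' = Suc (2 * ?m)"
            using l us by simp
          then have "\<phi> (mult_word (y # ys) (us @ x # vs)) =
              \<phi> ((a * y * antipode_inv x) # mult_word ys us')" for x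
            using mult_word_ends[OF False, where z = us' and y = y and a = a and c = x] Nil us by simp
          then show ?thesis
            by (simp only:) (intro linear_form_conj multilinear_formD(2)[OF \<phi>])
        next
          case (snoc vs' c)
          then have l': "length us' + length vs' + 1 = Suc (2 * ?m)"
            using l us by simp
          then have "\<phi> (mult_word (y # ys) (us @ x # vs)) =
              \<phi> ((a * y * antipode_inv c) # mult_word ys (us' @ x # vs'))" for x
            using mult_word_ends[OF False, where z = "us' @ x # vs'" and y = y and a = a and c = c] snoc us
            by simp
          then show ?thesis
            using multilinear_on_lengthD[OF Cons.IH[OF multilinear_form_Cons[OF \<phi>] False] l']
            by (simp only:)
        qed
      qed
    qed
  qed
qed simp

text \<open>Both sides obey the same recursion in \<open>ys\<close>: on the left by
  \<open>ev_comult_iter_ends\<close> and \<open>mult_word_ends\<close>, on the right by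
  \<open>act_Cons\<close>.\<close>

lemma ev_mult_word:
  "multilinear_form \<phi> \<Longrightarrow> ys \<noteq> [] \<Longrightarrow>
    ev (\<lambda>z. \<phi> (mult_word ys z)) (comult_iter (2 * (length ys - 1)) x) = act \<phi> x ys"
proof (induction ys arbitrary: \<phi> x)
  case (Cons y ys)
  note \<phi> = Cons.prems(1)
  show ?case
  proof (cases "ys = []")
    case False
    let ?r = "2 * (length ys - 1)"
    have len: "2 * (length (y # ys) - 1) = Suc (Suc ?r)"
      using False by (cases ys) auto
    have "ev (\<lambda>z. \<phi> (mult_word (y # ys) z)) (comult_iter (2 * (length (y # ys) - 1)) x) =
        sw3 (\<lambda>a b c. ev (\<lambda>z. \<phi> (mult_word (y # ys) (a # z @ [c]))) (comult_iter ?r b)) x"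
      using multilinear_mult_word[OF \<phi>, of "y # ys"] unfolding len
      by (intro ev_comult_iter_ends) simp
    also have "\<dots> = sw3 (\<lambda>a b c. ev (\<lambda>z. \<phi> ((a * y * antipode_inv c) # mult_word ys z)) (comult_iter ?r b)) x"
      by (intro sw2_cong ev_cong arg_cong[of _ _ \<phi>] mult_word_ends False length_comult_iter)
    also have "\<dots> = act \<phi> x (y # ys)"
      unfolding act_Cons[OF False] by (intro sw2_cong Cons.IH multilinear_form_Cons \<phi> False)
    finally show ?thesis .
  qed simp
qed simp

lemma ev_K_mult_word:
  assumes "multilinear_form \<phi>" "ys \<noteq> []"
  shows "ev \<phi> (K_mult_word xs ys) = kmul \<phi> xs ys"
  unfolding K_mult_word_def Let_def ev_lin_ext ev_word kmul_def
  by (rule ev_mult_word[OF multilinear_form_append[OF assms(1)] assms(2)])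

lemma ev_comult_sum: "(\<Sum>j<length xs - 1. (- 1) ^ j * ev \<phi> (comult_at j xs)) = del \<phi> xs"
proof (induction \<phi> xs rule: del.induct)
  case (3 \<phi> x y ys)
  have "(\<Sum>j<length (y # ys) - 1. (- 1) ^ j * ev \<phi> (comult_at (Suc j) (x # y # ys))) =
      (\<Sum>j<length (y # ys) - 1. (- 1) ^ j * ev (\<lambda>w. \<phi> (x # w)) (comult_at j (y # ys)))"
    by (simp add: ev_comult_at)
  with 3 show ?case
    by (simp add: sum.lessThan_Suc_shift sum_negf ev_comult_at del: sum.lessThan_Suc)
qed simp_all

lemma ev_K_diff_word:
  assumes \<phi>: "multilinear_form \<phi>" and xs: "xs \<noteq> []"
  shows "ev \<phi> (K_diff_word xs) = kdiff \<phi> xs"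
proof -
  \<comment> \<open>For m = 1 and both factors of y equal to 1, the product formula is literally the
    last term of the differential.\<close>
  have e: "lin_ext wscale (\<lambda>z. word (butlast xs @ [z ! 0 * antipode_inv (z ! 2), z ! 1]))
      (comult_iter 2 (last xs)) = K_mult_word xs [1, 1]"
    by (simp add: K_mult_word_def)
  have "ev \<phi> (K_diff_word xs) =
      - \<phi> (1 # xs) + del \<phi> xs + (- 1) ^ (length xs - 1) * ev \<phi> (K_mult_word xs [1, 1])"
    unfolding K_diff_word_def Let_def e
    by (simp add: ev_add ev_diff ev_uminus ev_sum ev_wscale ev_comult_sum[simplified])
  then show ?thesis
    using \<phi> xs by (simp add: ev_K_mult_word kdiff_def kmul_Cons act_one multilinear_form_Cons)
qed

end

section \<open>The differential graded algebra of classes\<close>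

context bijective_hopf_algebra
begin

definition K_rep :: "('h list \<Rightarrow>\<^sub>0 'k) set" where
  "K_rep = {p. Poly_Mapping.keys p \<subseteq> {xs. xs \<noteq> []}}"

definition K_rep_degree :: "nat \<Rightarrow> ('h list \<Rightarrow>\<^sub>0 'k) set" where
  "K_rep_degree n = {p. Poly_Mapping.keys p \<subseteq> {xs. length xs = Suc n}}"

definition kprod :: "('h list \<Rightarrow>\<^sub>0 'k) \<Rightarrow> ('h list \<Rightarrow>\<^sub>0 'k) \<Rightarrow> ('h list \<Rightarrow>\<^sub>0 'k)" where
  "kprod p q = lin_ext wscale (\<lambda>xs. lin_ext wscale (K_mult_word xs) q) p"

definition kd :: "('h list \<Rightarrow>\<^sub>0 'k) \<Rightarrow> ('h list \<Rightarrow>\<^sub>0 'k)" where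
  "kd p = lin_ext wscale K_diff_word p"

definition component :: "nat \<Rightarrow> ('h list \<Rightarrow>\<^sub>0 'k) \<Rightarrow> ('h list \<Rightarrow>\<^sub>0 'k)" where
  "component n p = lin_ext wscale (\<lambda>w. if length w = Suc n then word w else 0) p"

lemma subspace_K_rep: "words.subspace K_rep"
  unfolding K_rep_def using words.subspace_span[of "word ` {xs. xs \<noteq> []}"] by (simp add: span_word)

lemma subspace_K_rep_degree: "words.subspace (K_rep_degree n)"
  unfolding K_rep_degree_def
  using words.subspace_span[of "word ` {xs. length xs = Suc n}"] by (simp add: span_word)

lemma K_rep_degree_subset: "K_rep_degree n \<subseteq> K_rep"
  by (auto simp: K_rep_def K_rep_degree_def)

lemma K_repD: "p \<in> K_rep \<Longrightarrow> xs \<in> Poly_Mapping.keys p \<Longrightarrow> xs \<noteq> []"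
  by (auto simp: K_rep_def)

lemma K_rep_degreeD: "p \<in> K_rep_degree n \<Longrightarrow> xs \<in> Poly_Mapping.keys p \<Longrightarrow> length xs = Suc n"
  by (auto simp: K_rep_degree_def)

text \<open>The operations on classes run over all representatives, so it must be excluded that one
  of them involves the empty word. The indicator of \<open>[]\<close> is multilinear, so the
  coefficient there is an invariant of the class.\<close>

lemma tclass_K_rep:
  assumes "tclass p = tclass q" "q \<in> K_rep"
  shows "p \<in> K_rep"
proof -
  let ?\<delta> = "\<lambda>w. if w = [] then 1 else (0 :: 'k)"
  have ev: "ev ?\<delta> p = Poly_Mapping.lookup p []" for p
    by (simp add: lin_ext_def if_distrib in_keys_iff cong: if_cong)
  have "multilinear_form ?\<delta>"
    by (simp add: multilinear_form_def linear_form_def)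
  then have "Poly_Mapping.lookup p [] = Poly_Mapping.lookup q []"
    using ev_cong_tclass[OF assms(1)] ev by metis
  moreover have "Poly_Mapping.lookup q [] = 0"
    using assms(2) by (auto simp: K_rep_def in_keys_iff)
  ultimately show ?thesis
    by (auto simp: K_rep_def in_keys_iff)
qed

lemma multilinear_form_ev:
  assumes "\<And>v. multilinear_form (g v)"
  shows "multilinear_form (\<lambda>w. ev (\<lambda>v. g v w) p)"
  by (rule multilinear_formI) (intro linear_form_ev multilinear_formD(1) assms)

text \<open>At \<open>ys = []\<close> the form \<open>act\<close> has the default value 0, whereas
  \<open>K_mult_word\<close> gives an unspecified word; the support of q avoids this case.\<close>

lemma ev_kprod:
  assumes "multilinear_form \<phi>" "q \<in> K_rep"
  shows "ev \<phi> (kprod p q) = ev (\<lambda>xs. ev (\<lambda>ys. kmul \<phi> xs ys) q) p"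
  unfolding kprod_def ev_lin_ext
  by (intro ev_cong ev_K_mult_word assms(1) K_repD[OF assms(2)])

lemma ev_kd:
  assumes "multilinear_form \<phi>" "p \<in> K_rep"
  shows "ev \<phi> (kd p) = ev (kdiff \<phi>) p"
  unfolding kd_def ev_lin_ext
  by (intro ev_cong ev_K_diff_word assms(1) K_repD[OF assms(2)])

lemma keys_K_mult_word:
  "Poly_Mapping.keys (K_mult_word xs ys) \<subseteq> {w. length w = length xs - 1 + (length ys - 1) + 1}"
  unfolding K_mult_word_def Let_def by (intro keys_lin_ext) simp

lemma kprod_degree: "p \<in> K_rep_degree n \<Longrightarrow> q \<in> K_rep_degree m \<Longrightarrow> kprod p q \<in> K_rep_degree (n + m)"
  unfolding kprod_def K_rep_degree_def mem_Collect_eq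
  using keys_K_mult_word by (intro keys_lin_ext) fastforce

lemma kprod_closed: "kprod p q \<in> K_rep"
  unfolding kprod_def K_rep_def mem_Collect_eq
  using keys_K_mult_word by (intro keys_lin_ext) fastforce

lemma K_diff_word_degree:
  assumes "length xs = Suc n"
  shows "K_diff_word xs \<in> K_rep_degree (Suc n)"
proof -
  note closed = words.subspace_add words.subspace_neg words.subspace_sum words.subspace_scale
  have "lin_ext wscale (\<lambda>z. word (butlast xs @ [z ! 0 * antipode_inv (z ! 2), z ! 1]))
      (comult_iter 2 (last xs)) \<in> K_rep_degree (Suc n)"
    unfolding K_rep_degree_def mem_Collect_eq by (intro keys_lin_ext) (simp add: assms)
  moreover have "comult_at j xs \<in> K_rep_degree (Suc n)" if "j < n" for j
    unfolding K_rep_degree_def mem_Collect_eq comult_at_def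
    using that assms by (intro keys_lin_ext) (auto dest!: length_sweedler)
  moreover have "word (1 # xs) \<in> K_rep_degree (Suc n)"
    by (simp add: K_rep_degree_def assms)
  ultimately show ?thesis
    unfolding K_diff_word_def Let_def
    using assms by (intro closed[OF subspace_K_rep_degree]) auto
qed

lemma kd_degree: "p \<in> K_rep_degree n \<Longrightarrow> kd p \<in> K_rep_degree (Suc n)"
  using K_diff_word_degree unfolding kd_def K_rep_degree_def mem_Collect_eq
  by (intro keys_lin_ext) auto

lemma kd_closed: "p \<in> K_rep \<Longrightarrow> kd p \<in> K_rep"
proof -
  assume p: "p \<in> K_rep"
  have "Poly_Mapping.keys (K_diff_word xs) \<subseteq> {w. w \<noteq> []}" if xs: "xs \<in> Poly_Mapping.keys p" for xs
  proof -
    obtain n where "length xs = Suc n"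
      by (cases xs) (use K_repD[OF p xs] in auto)
    then show ?thesis
      using K_diff_word_degree K_rep_degree_subset unfolding K_rep_def by blast
  qed
  then show ?thesis
    unfolding kd_def K_rep_def mem_Collect_eq by (intro keys_lin_ext)
qed

text \<open>Representatives are replaced one argument at a time: \<open>kmul\<close> is multilinear
  in its right word, and remains so in its left word after summation over q.\<close>

lemma K_mult_tclass:
  assumes "p \<in> K_rep" "q \<in> K_rep"
  shows "K_mult (tclass p) (tclass q) = tclass (kprod p q)"
  unfolding K_mult_def kprod_def[symmetric]
proof (rule UN2_tclass)
  fix p' q'
  assume p': "tclass p' = tclass p" and q': "tclass q' = tclass q"
  show "tclass (kprod p' q') = tclass (kprod p q)"
    unfolding tclass_eq_iff
  proof (intro allI impI)
    fix \<phi> :: "'h list \<Rightarrow> 'k"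
    assume \<phi>: "multilinear_form \<phi>"
    have "ev \<phi> (kprod p' q') = ev (\<lambda>xs. ev (\<lambda>ys. kmul \<phi> xs ys) q') p'"
      by (intro ev_kprod \<phi> tclass_K_rep[OF q' assms(2)])
    also have "\<dots> = ev (\<lambda>xs. ev (\<lambda>ys. kmul \<phi> xs ys) q) p'"
      by (intro ev_cong ev_cong_tclass[OF q'] multilinear_form_kmul_right \<phi>)
    also have "\<dots> = ev (\<lambda>xs. ev (\<lambda>ys. kmul \<phi> xs ys) q) p"
      by (intro ev_cong_tclass[OF p'] multilinear_form_ev multilinear_form_kmul_left \<phi>)
    also have "\<dots> = ev \<phi> (kprod p q)"
      by (intro ev_kprod[symmetric] \<phi> assms)
    finally show "ev \<phi> (kprod p' q') = ev \<phi> (kprod p q)" .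
  qed
qed

lemma K_diff_tclass:
  assumes "p \<in> K_rep"
  shows "K_diff (tclass p) = tclass (kd p)"
  unfolding K_diff_def kd_def[symmetric]
proof (rule UN_tclass)
  fix p'
  assume p': "tclass p' = tclass p"
  then show "tclass (kd p') = tclass (kd p)"
    using ev_cong_tclass[OF p' multilinear_form_kdiff] tclass_K_rep[OF p' assms] assms
    by (simp add: tclass_eq_iff ev_kd)
qed

section \<open>The identities of the algebra and of the differential, modulo the tensor
  relations\<close>

lemma kprod_assoc:
  assumes "p \<in> K_rep" "q \<in> K_rep" "r \<in> K_rep"
  shows "tclass (kprod (kprod p q) r) = tclass (kprod p (kprod q r))"
  unfolding tclass_eq_iff
proof (intro allI impI)
  fix \<phi> :: "'h list \<Rightarrow> 'k"
  assume \<phi>: "multilinear_form \<phi>"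
  have "ev \<phi> (kprod (kprod p q) r) =
      ev (\<lambda>xs. ev (\<lambda>ys. kmul (\<lambda>w. ev (\<lambda>zs. kmul \<phi> w zs) r) xs ys) q) p"
    using \<phi> assms by (simp add: ev_kprod multilinear_form_ev multilinear_form_kmul_left)
  also have "\<dots> = ev (\<lambda>xs. ev (\<lambda>ys. ev (\<lambda>zs. kmul (\<lambda>w. kmul \<phi> w zs) xs ys) r) q) p"
    by (simp only: kmul_ev)
  also have "\<dots> = ev (\<lambda>xs. ev (\<lambda>ys. ev (\<lambda>zs. kmul (kmul \<phi> xs) ys zs) r) q) p"
    by (intro ev_cong kmul_assoc \<phi> K_repD[OF assms(1)] K_repD[OF assms(2)] K_repD[OF assms(3)])
  also have "\<dots> = ev \<phi> (kprod p (kprod q r))"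
    using \<phi> assms by (simp add: ev_kprod kprod_closed multilinear_form_kmul_right)
  finally show "ev \<phi> (kprod (kprod p q) r) = ev \<phi> (kprod p (kprod q r))" .
qed

lemma kprod_add_left: "kprod (p + q) r = kprod p r + kprod q r"
  and kprod_scale_left: "kprod (wscale c p) r = wscale c (kprod p r)"
  by (simp_all add: kprod_def words.lin_ext_add words.lin_ext_wscale)

lemma kprod_add_right:
  "q \<in> K_rep \<Longrightarrow> r \<in> K_rep \<Longrightarrow> tclass (kprod p (q + r)) = tclass (kprod p q + kprod p r)"
  by (simp add: tclass_eq_iff ev_kprod ev_add ev_fun_add words.subspace_add[OF subspace_K_rep])

lemma kprod_scale_right:
  "q \<in> K_rep \<Longrightarrow> tclass (kprod p (wscale c q)) = tclass (wscale c (kprod p q))"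
  by (simp add: tclass_eq_iff ev_kprod ev_wscale ev_fun_mult words.subspace_scale[OF subspace_K_rep])

lemma kd_add: "kd (p + q) = kd p + kd q"
  and kd_scale: "kd (wscale c p) = wscale c (kd p)"
  by (simp_all add: kd_def words.lin_ext_add words.lin_ext_wscale)

lemma kdiff_ev: "kdiff (\<lambda>w. ev (\<lambda>v. g v w) p) xs = ev (\<lambda>v. kdiff (g v) xs) p"
  by (simp add: kdiff_def kmul_ev del_ev ev_fun_add ev_fun_diff ev_fun_uminus ev_fun_mult)

lemma kd_kprod:
  assumes p: "p \<in> K_rep_degree n" and q: "q \<in> K_rep"
  shows "tclass (kd (kprod p q)) = tclass (kprod (kd p) q + wscale ((- 1) ^ n) (kprod p (kd q)))"
  unfolding tclass_eq_iff
proof (intro allI impI)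
  fix \<phi> :: "'h list \<Rightarrow> 'k"
  assume \<phi>: "multilinear_form \<phi>"
  have p': "p \<in> K_rep"
    using p K_rep_degree_subset by blast
  have "ev \<phi> (kd (kprod p q)) = ev (\<lambda>xs. ev (\<lambda>ys. kmul (kdiff \<phi>) xs ys) q) p"
    using \<phi> q by (simp add: ev_kd ev_kprod kprod_closed multilinear_form_kdiff)
  also have "\<dots> = ev (\<lambda>xs. ev (\<lambda>ys. kdiff (\<lambda>w. kmul \<phi> w ys) xs + (- 1) ^ n * kdiff (kmul \<phi> xs) ys) q) p"
  proof (intro ev_cong)
    fix xs ys
    assume xs: "xs \<in> Poly_Mapping.keys p" and ys: "ys \<in> Poly_Mapping.keys q"
    show "kmul (kdiff \<phi>) xs ys = kdiff (\<lambda>w. kmul \<phi> w ys) xs + (- 1) ^ n * kdiff (kmul \<phi> xs) ys"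
      using kmul_kdiff[OF \<phi> K_repD[OF p' xs] K_repD[OF q ys]] K_rep_degreeD[OF p xs] by simp
  qed
  also have "\<dots> = ev (kdiff (\<lambda>w. ev (\<lambda>ys. kmul \<phi> w ys) q)) p + (- 1) ^ n * ev (\<lambda>xs. ev (kdiff (kmul \<phi> xs)) q) p"
    by (simp only: ev_fun_add ev_fun_mult kdiff_ev[symmetric])
  also have "\<dots> = ev \<phi> (kprod (kd p) q + wscale ((- 1) ^ n) (kprod p (kd q)))"
    using \<phi> p' q
    by (simp add: ev_add ev_wscale ev_kprod ev_kd kd_closed multilinear_form_ev
        multilinear_form_kmul_left multilinear_form_kmul_right)
  finally show "ev \<phi> (kd (kprod p q)) = ev \<phi> (kprod (kd p) q + wscale ((- 1) ^ n) (kprod p (kd q)))" .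
qed

lemma kd_kd:
  assumes "p \<in> K_rep"
  shows "tclass (kd (kd p)) = tclass 0"
  unfolding tclass_eq_iff
proof (intro allI impI)
  fix \<phi> :: "'h list \<Rightarrow> 'k"
  assume \<phi>: "multilinear_form \<phi>"
  have "ev \<phi> (kd (kd p)) = ev (kdiff (kdiff \<phi>)) p"
    using \<phi> assms by (simp add: ev_kd kd_closed multilinear_form_kdiff)
  also have "\<dots> = ev (\<lambda>w. 0) p"
    by (intro ev_cong kdiff_kdiff \<phi> K_repD[OF assms])
  finally show "ev \<phi> (kd (kd p)) = ev \<phi> 0"
    by (simp add: ev_fun_zero)
qed

lemma ev_component: "ev \<phi> (component n p) = ev (\<lambda>w. if length w = Suc n then \<phi> w else 0) p"
  unfolding component_def ev_lin_ext by (intro ev_cong) simp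

lemma component_degree: "component n p \<in> K_rep_degree n"
  unfolding component_def K_rep_degree_def mem_Collect_eq by (intro keys_lin_ext) auto

lemma K_algebra_simps [simp]:
  "carrier K_algebra = tclass ` K_rep" "monoid.mult K_algebra = K_mult"
  "one K_algebra = tclass (word [1])" "ring.zero K_algebra = tclass 0"
  "add K_algebra = tadd" "module.smult K_algebra = tscale"
  by (simp_all add: K_algebra_def span_quotient K_rep_def)

lemma K_degree_eq: "K_degree n = tclass ` K_rep_degree n"
  by (simp add: K_degree_def tensor_power_def span_quotient K_rep_degree_def)

lemmas K_rep_closed [simp] = words.subspace_0[OF subspace_K_rep] words.subspace_add[OF subspace_K_rep]
  words.subspace_neg[OF subspace_K_rep] words.subspace_scale[OF subspace_K_rep] kprod_closed kd_closed

lemma word_one_K_rep: "word [1] \<in> K_rep_degree 0"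
  by (simp add: K_rep_degree_def)

section \<open>Ring, module and grading structure on classes\<close>

lemma abelian_group_K_algebra: "abelian_group K_algebra"
proof (rule abelian_groupI)
  fix x
  assume "x \<in> carrier K_algebra"
  then obtain p where p: "x = tclass p" "p \<in> K_rep"
    by auto
  then show "\<exists>y\<in>carrier K_algebra. y \<oplus>\<^bsub>K_algebra\<^esub> x = \<zero>\<^bsub>K_algebra\<^esub>"
    by (intro bexI[of _ "tclass (- p)"]) (auto simp: tadd_tclass)
qed (auto simp: tadd_tclass add_ac)

lemma ring_K_algebra: "ring K_algebra"
proof (rule ringI)
  show "Group.monoid K_algebra"
  proof (rule monoidI)
    fix x
    assume "x \<in> carrier K_algebra"
    then obtain p where p: "x = tclass p" "p \<in> K_rep"
      by auto
    have one: "word [1] \<in> K_rep"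
      using word_one_K_rep K_rep_degree_subset by blast
    have "ev (\<lambda>xs. kmul \<phi> [1] xs) p = ev \<phi> p" if "multilinear_form \<phi>" for \<phi> :: "'h list \<Rightarrow> 'k"
      by (intro ev_cong kmul_one_left that K_repD[OF p(2)])
    then show "\<one>\<^bsub>K_algebra\<^esub> \<otimes>\<^bsub>K_algebra\<^esub> x = x"
      using p one by (simp add: K_mult_tclass tclass_eq_iff ev_kprod del: kmul_singleton)
    have "ev (\<lambda>xs. kmul \<phi> xs [1]) p = ev \<phi> p" for \<phi> :: "'h list \<Rightarrow> 'k"
      by (intro ev_cong kmul_one_right K_repD[OF p(2)])
    then show "x \<otimes>\<^bsub>K_algebra\<^esub> \<one>\<^bsub>K_algebra\<^esub> = x"
      using p one by (simp add: K_mult_tclass tclass_eq_iff ev_kprod)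
  qed (use word_one_K_rep K_rep_degree_subset in \<open>auto simp: K_mult_tclass kprod_assoc\<close>)
qed (auto simp: abelian_group_K_algebra tadd_tclass K_mult_tclass kprod_add_left kprod_add_right)

lemma module_K_algebra: "Module.module (ring_of_type_algebra :: 'k ring) K_algebra"
  by (rule Module.moduleI[OF cring_from_type_algebra abelian_group_K_algebra])
    (auto simp: ring_of_type_algebra_def tadd_tclass tscale_tclass words.scale_left_distrib
      words.scale_right_distrib)

lemma K_degree_submodule:
  "submodule (K_degree n) (ring_of_type_algebra :: 'k ring) K_algebra"
proof -
  interpret K: abelian_group K_algebra
    by (rule abelian_group_K_algebra)
  have neg: "\<ominus>\<^bsub>K_algebra\<^esub> tclass p = tclass (- p)" if "p \<in> K_rep" for p
    by (rule K.minus_equality) (use that in \<open>auto simp: tadd_tclass\<close>)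
  note closed = words.subspace_0[OF subspace_K_rep_degree] words.subspace_add[OF subspace_K_rep_degree]
    words.subspace_neg[OF subspace_K_rep_degree] words.subspace_scale[OF subspace_K_rep_degree]
  show ?thesis
    by (rule Module.module.submoduleI[OF module_K_algebra])
      (use K_rep_degree_subset[of n] in
        \<open>auto simp: K_degree_eq neg tadd_tclass tscale_tclass closed subset_iff\<close>)
qed

lemma finsum_K_algebra:
  assumes "finite I" "\<And>n. n \<in> I \<Longrightarrow> g n \<in> K_rep"
  shows "(\<Oplus>\<^bsub>K_algebra\<^esub>n\<in>I. tclass (g n)) = tclass (\<Sum>n\<in>I. g n)"
proof -
  interpret K: abelian_group K_algebra
    by (rule abelian_group_K_algebra)
  show ?thesis
    using assms
    by (induction I rule: finite_induct) (auto simp: tadd_tclass Pi_def)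
qed

text \<open>Existence takes the parts of a representative by length. For uniqueness, a form cut off
  to length m + 1 sees only the part of degree m, so the class of p determines the class of that
  part.\<close>

lemma K_algebra_direct_sum:
  assumes "x \<in> carrier K_algebra"
  shows "\<exists>!f. (\<forall>n. f n \<in> K_degree n) \<and> finite {n. f n \<noteq> \<zero>\<^bsub>K_algebra\<^esub>} \<and>
    x = (\<Oplus>\<^bsub>K_algebra\<^esub>n\<in>{n. f n \<noteq> \<zero>\<^bsub>K_algebra\<^esub>}. f n)"
proof -
  obtain p where p: "x = tclass p" "p \<in> K_rep"
    using assms by auto
  define f where "f = (\<lambda>n. tclass (component n p))"
  \<comment> \<open>The degrees that occur in p. A component may be nonzero with class zero, so J
    can be larger than the index set of the direct sum.\<close>
  define J where "J = (\<lambda>w :: 'h list. length w - 1) ` Poly_Mapping.keys p"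
  have "finite J"
    by (simp add: J_def)
  have zero: "component n p = 0" if "n \<notin> J" for n
  proof -
    have "lin_ext wscale (\<lambda>w. if length w = Suc n then word w else 0) p = lin_ext wscale (\<lambda>w. 0) p"
      using that by (intro words.lin_ext_cong) (force simp: J_def)
    then show ?thesis
      by (simp add: component_def lin_ext_def)
  qed
  have J: "{n. f n \<noteq> tclass 0} \<subseteq> J"
    using zero by (auto simp: f_def)
  then have fin: "finite {n. f n \<noteq> tclass 0}"
    using \<open>finite J\<close> finite_subset by blast
  have "(\<Oplus>\<^bsub>K_algebra\<^esub>n\<in>{n. f n \<noteq> tclass 0}. f n) = tclass (\<Sum>n\<in>{n. f n \<noteq> tclass 0}. component n p)"
    unfolding f_def by (rule finsum_K_algebra)
      (use fin component_degree K_rep_degree_subset in \<open>auto simp: f_def\<close>)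
  also have "\<dots> = x"
    unfolding p(1) tclass_eq_iff
  proof (intro allI impI)
    fix \<phi> :: "'h list \<Rightarrow> 'k"
    assume \<phi>: "multilinear_form \<phi>"
    \<comment> \<open>The additional degrees in J have components of class zero, on which every
      multilinear form vanishes.\<close>
    have "ev \<phi> (\<Sum>n\<in>{n. f n \<noteq> tclass 0}. component n p) = (\<Sum>n\<in>J. ev \<phi> (component n p))"
      unfolding ev_sum
      by (rule sum.mono_neutral_left[OF \<open>finite J\<close> J])
        (use ev_cong_tclass[OF _ \<phi>, of _ 0] in \<open>auto simp: f_def\<close>)
    also have "\<dots> = (\<Sum>n\<in>J. \<Sum>w\<in>Poly_Mapping.keys p.
        if length w = Suc n then Poly_Mapping.lookup p w * \<phi> w else 0)"
      unfolding ev_component unfolding lin_ext_def by (intro sum.cong) auto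
    also have "\<dots> = (\<Sum>w\<in>Poly_Mapping.keys p. \<Sum>n\<in>J.
        if n = length w - 1 then Poly_Mapping.lookup p w * \<phi> w else 0)"
      \<comment> \<open>Words of p are nonempty, so each has exactly one degree, and truncated
        subtraction computes it correctly.\<close>
      by (subst sum.swap) (use K_repD[OF p(2)] in \<open>force intro!: sum.cong simp: Suc_length_conv neq_Nil_conv\<close>)
    also have "\<dots> = ev \<phi> p"
      using \<open>finite J\<close> by (auto simp: lin_ext_def J_def intro!: sum.cong)
    finally show "ev \<phi> (\<Sum>n\<in>{n. f n \<noteq> tclass 0}. component n p) = ev \<phi> p" .
  qed
  finally have sum: "x = (\<Oplus>\<^bsub>K_algebra\<^esub>n\<in>{n. f n \<noteq> tclass 0}. f n)" ..
  show ?thesis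
  proof (rule ex1I[of _ f])
    show "(\<forall>n. f n \<in> K_degree n) \<and> finite {n. f n \<noteq> \<zero>\<^bsub>K_algebra\<^esub>} \<and>
      x = (\<Oplus>\<^bsub>K_algebra\<^esub>n\<in>{n. f n \<noteq> \<zero>\<^bsub>K_algebra\<^esub>}. f n)"
      using fin sum by (auto simp: f_def K_degree_eq component_degree)
  next
    fix f'
    assume f': "(\<forall>n. f' n \<in> K_degree n) \<and> finite {n. f' n \<noteq> \<zero>\<^bsub>K_algebra\<^esub>} \<and>
      x = (\<Oplus>\<^bsub>K_algebra\<^esub>n\<in>{n. f' n \<noteq> \<zero>\<^bsub>K_algebra\<^esub>}. f' n)"
    then have "\<forall>n. \<exists>q. q \<in> K_rep_degree n \<and> f' n = tclass q"
      by (auto simp: K_degree_eq)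
    then obtain g where g: "g n \<in> K_rep_degree n" "f' n = tclass (g n)" for n
      by metis
    let ?I = "{n. tclass (g n) \<noteq> tclass 0}"
    have I: "finite ?I" and "x = (\<Oplus>\<^bsub>K_algebra\<^esub>n\<in>?I. tclass (g n))"
      using f' by (simp_all add: g(2))
    then have px: "tclass p = tclass (\<Sum>n\<in>?I. g n)"
      using finsum_K_algebra[OF I, of g] g(1) K_rep_degree_subset by (auto simp: p(1))
    show "f' = f"
    proof
      fix m
      show "f' m = f m"
        unfolding f_def g(2) tclass_eq_iff
      proof (intro allI impI)
        fix \<phi> :: "'h list \<Rightarrow> 'k"
        assume \<phi>: "multilinear_form \<phi>"
        let ?\<phi> = "\<lambda>w. if length w = Suc m then \<phi> w else 0"
        have "ev ?\<phi> (g n) = (if n = m then ev \<phi> (g n) else 0)" for n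
        proof -
          have "ev ?\<phi> (g n) = ev (\<lambda>w. if n = m then \<phi> w else 0) (g n)"
            by (intro ev_cong) (auto dest: K_rep_degreeD[OF g(1)])
          then show ?thesis
            by (simp add: ev_fun_zero)
        qed
        then have "ev \<phi> (component m p) = (\<Sum>n\<in>?I. if n = m then ev \<phi> (g n) else 0)"
          by (simp add: ev_component ev_sum ev_cong_tclass[OF px multilinear_form_if_length[OF \<phi>]])
        \<comment> \<open>If m is not in the index set, then \<open>g m\<close> has class zero and
          the right-hand side vanishes as well.\<close>
        also have "\<dots> = ev \<phi> (g m)"
          using I ev_cong_tclass[OF _ \<phi>, of "g m" 0] by auto
        finally show "ev \<phi> (g m) = ev \<phi> (component m p)" ..
      qed
    qed
  qed
qed

lemma sign_ring_of_type_algebra: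
  "(\<ominus>\<^bsub>ring_of_type_algebra :: 'k ring\<^esub> \<one>\<^bsub>ring_of_type_algebra :: 'k ring\<^esub>)
    [^]\<^bsub>ring_of_type_algebra :: 'k ring\<^esub> (n :: nat) = (- 1) ^ n"
proof -
  interpret R: cring "ring_of_type_algebra :: 'k ring"
    by (rule cring_from_type_algebra)
  have "\<ominus>\<^bsub>ring_of_type_algebra :: 'k ring\<^esub> \<one>\<^bsub>ring_of_type_algebra :: 'k ring\<^esub> = - 1"
    by (rule R.minus_equality) (auto simp: ring_of_type_algebra_def)
  then show ?thesis
    by (induction n) (simp_all add: ring_of_type_algebra_def)
qed

lemma dg_algebra_K_algebra:
  "dg_algebra (ring_of_type_algebra :: 'k ring) K_algebra K_degree K_diff"
proof -
  have smult: "assoc_algebra_axioms (ring_of_type_algebra :: 'k ring) K_algebra"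
    by unfold_locales
      (auto simp: tscale_tclass K_mult_tclass kprod_scale_left kprod_scale_right)
  have graded: "graded_algebra_axioms (ring_of_type_algebra :: 'k ring) K_algebra K_degree"
  proof (rule graded_algebra_axioms.intro)
    show "\<one>\<^bsub>K_algebra\<^esub> \<in> K_degree 0"
      using word_one_K_rep by (simp add: K_degree_eq)
    show "x \<otimes>\<^bsub>K_algebra\<^esub> y \<in> K_degree (n + m)" if "x \<in> K_degree n" "y \<in> K_degree m" for x y n m
    proof -
      obtain p q where "x = tclass p" "p \<in> K_rep_degree n" "y = tclass q" "q \<in> K_rep_degree m"
        using \<open>x \<in> K_degree n\<close> \<open>y \<in> K_degree m\<close> by (auto simp: K_degree_eq)
      then show ?thesis
        using kprod_degree[of p n q m] subsetD[OF K_rep_degree_subset]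
        by (auto simp: K_degree_eq K_mult_tclass)
    qed
  qed (rule K_degree_submodule, rule K_algebra_direct_sum)
  have dg: "dg_algebra_axioms (ring_of_type_algebra :: 'k ring) K_algebra K_degree K_diff"
  proof unfold_locales
    fix x y n m
    assume "x \<in> K_degree n" "y \<in> K_degree m"
    then obtain p q where "x = tclass p" "p \<in> K_rep_degree n" "y = tclass q" "q \<in> K_rep_degree m"
      by (auto simp: K_degree_eq)
    moreover from this have "p \<in> K_rep" "q \<in> K_rep"
      using K_rep_degree_subset by blast+
    ultimately show "K_diff (x \<otimes>\<^bsub>K_algebra\<^esub> y) = (K_diff x \<otimes>\<^bsub>K_algebra\<^esub> y) \<oplus>\<^bsub>K_algebra\<^esub>
        ((\<ominus>\<^bsub>ring_of_type_algebra :: 'k ring\<^esub> \<one>\<^bsub>ring_of_type_algebra :: 'k ring\<^esub>)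
          [^]\<^bsub>ring_of_type_algebra :: 'k ring\<^esub> n) \<odot>\<^bsub>K_algebra\<^esub> (x \<otimes>\<^bsub>K_algebra\<^esub> K_diff y)"
      unfolding sign_ring_of_type_algebra
      by (simp add: K_mult_tclass K_diff_tclass tscale_tclass tadd_tclass kd_kprod)
  qed (use K_rep_degree_subset kd_degree in
      \<open>auto simp: K_degree_eq K_diff_tclass tadd_tclass tscale_tclass kd_kd kd_add kd_scale subset_iff\<close>)
  show ?thesis
    by (intro dg_algebra.intro graded_algebra.intro assoc_algebra.intro module_K_algebra
        ring_K_algebra smult graded dg)
qed

end

theorem proposition3p4:
  fixes scale :: "'k::field \<Rightarrow> 'h::ring_1 \<Rightarrow> 'h"
    and comult :: "'h \<Rightarrow> ('h list \<Rightarrow>\<^sub>0 'k) set"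
    and counit :: "'h \<Rightarrow> 'k"
    and antipode :: "'h \<Rightarrow> 'h"
  assumes "hopf_algebra scale comult counit antipode"
    and "bij antipode"
  shows "dg_algebra (ring_of_type_algebra :: 'k ring)
    (hopf_algebra.K_algebra scale comult antipode)
    (hopf_algebra.K_degree scale)
    (hopf_algebra.K_diff scale comult antipode)"
proof -
  interpret bijective_hopf_algebra scale comult counit antipode
    using assms by (intro bijective_hopf_algebra.intro bijective_hopf_algebra_axioms.intro)
  show ?thesis
    by (rule dg_algebra_K_algebra)
qed

end
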